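(* Let $\nu\in[-1,\frac12]$, $\beta=1-\nu\in[\frac12,2]$, and let $\mathcal L$ be the operator with Fourier symbol $\frac{|k|^3}{\beta k_1^2+k_2^2}$. For every $u$ in the Schwartz space $\mathcal S(\mathbb{R}^2)$ and $x\in\mathbb{R}^2$, $$\mathcal L u(x)=-\frac1{4\pi}\int_{\mathbb{R}^2}\big(u(x+y)+u(x-y)-2u(x)\big)K(y)\,dy,$$ where $K(y):=9P(y_1/\sqrt\beta,\,y_2)$ satisfies $$(\beta\partial_1^2+\partial_2^2)K(y)=\frac{9}{|y|^5}\qquad\text{for all }y\in\mathbb{R}^2\setminus\{0\}.$$
   Context: $\mathcal L u:=\mathcal F^{-1}\big(\frac{|k|^3}{\beta k_1^2+k_2^2}\hat u(k)\big)$, where $k=(k_1,k_2)$, $|k|=\sqrt{k_1^2+k_2^2}$, and $\hat u(k)=\mathcal F u(k)=\int_{\mathbb{R}^2} u(x)e^{-ik\cdot x}\,dx$ (so $-\Delta$ has symbol $|k|^2$). The function $P$ on $\mathbb{R}^2\setminus\{0\}$ is $P(x_1,x_2)=\dfrac{v(\theta)}{(x_1^2+x_2^2)^{3/2}}$, where $\theta$ is the polar angle ($\tan\theta=x_2/x_1$) and $v$ is the unique $\pi$-periodic solution on $\mathbb{R}$ of $v''+9v=(\beta\cos^2\theta+\sin^2\theta)^{-5/2}$. *)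

theory Defs
  imports "HOL-Analysis.Analysis"
begin

text \<open>
  The plane is \<^typ>\<open>real \<times> real\<close>; its norm, inner product and \<^term>\<open>lborel\<close> are the Euclidean
  ones, so \<open>fst k\<close>, \<open>snd k\<close> are the coordinates \<open>k\<^sub>1\<close>, \<open>k\<^sub>2\<close> and \<open>norm k = sqrt (k\<^sub>1\<^sup>2 + k\<^sub>2\<^sup>2)\<close>.
\<close>

definition partial1 :: "(real \<times> real \<Rightarrow> 'a::real_normed_vector) \<Rightarrow> real \<times> real \<Rightarrow> 'a" where
  "partial1 f x = vector_derivative (\<lambda>t. f (t, snd x)) (at (fst x))"

definition partial2 :: "(real \<times> real \<Rightarrow> 'a::real_normed_vector) \<Rightarrow> real \<times> real \<Rightarrow> 'a" where
  "partial2 f x = vector_derivative (\<lambda>t. f (fst x, t)) (at (snd x))"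

text \<open>
  \<open>vector_derivative\<close> is a total function, so existence of the derivatives has to be required
  separately. All \<open>\<partial>\<^sub>1\<^sup>a \<partial>\<^sub>2\<^sup>b u\<close> being (Frechet) differentiable is equivalent to \<open>u\<close> being
  smooth: the derivatives are then continuous, and mixed ones commute.
\<close>

definition schwartz :: "(real \<times> real \<Rightarrow> complex) \<Rightarrow> bool" where
  "schwartz u \<longleftrightarrow>
     (\<forall>a b x. ((partial1 ^^ a) ((partial2 ^^ b) u)) differentiable (at x)) \<and>
     (\<forall>m n a b. \<exists>C. \<forall>x.
        norm (of_real (fst x ^ m * snd x ^ n) * (partial1 ^^ a) ((partial2 ^^ b) u) x) \<le> C)"

definition fourier :: "(real \<times> real \<Rightarrow> complex) \<Rightarrow> real \<times> real \<Rightarrow> complex" where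
  "fourier u k = (LINT x|lborel. u x * exp (- \<i> * of_real (k \<bullet> x)))"

definition inverse_fourier :: "(real \<times> real \<Rightarrow> complex) \<Rightarrow> real \<times> real \<Rightarrow> complex" where
  "inverse_fourier g x = of_real (1 / (2 * pi)\<^sup>2) * (LINT k|lborel. g k * exp (\<i> * of_real (k \<bullet> x)))"

definition L_symbol :: "real \<Rightarrow> real \<times> real \<Rightarrow> real" where
  "L_symbol \<beta> k = norm k ^ 3 / (\<beta> * (fst k)\<^sup>2 + (snd k)\<^sup>2)"

definition L_op :: "real \<Rightarrow> (real \<times> real \<Rightarrow> complex) \<Rightarrow> real \<times> real \<Rightarrow> complex" where
  "L_op \<beta> u = inverse_fourier (\<lambda>k. of_real (L_symbol \<beta> k) * fourier u k)"

definition periodic_solution :: "real \<Rightarrow> (real \<Rightarrow> real) \<Rightarrow> bool" where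
  "periodic_solution \<beta> v \<longleftrightarrow>
     (\<forall>\<theta>. v (\<theta> + pi) = v \<theta>) \<and>
     (\<exists>v' v''. (\<forall>\<theta>. (v has_real_derivative v' \<theta>) (at \<theta>)) \<and>
               (\<forall>\<theta>. (v' has_real_derivative v'' \<theta>) (at \<theta>)) \<and>
               (\<forall>\<theta>. v'' \<theta> + 9 * v \<theta> = (\<beta> * (cos \<theta>)\<^sup>2 + (sin \<theta>)\<^sup>2) powr (- 5 / 2)))"

text \<open>
  For \<open>\<beta> > 0\<close> the solution is unique because the solutions \<open>cos (3 * \<theta>)\<close>, \<open>sin (3 * \<theta>)\<close> of the
  homogeneous equation change sign under a shift by \<open>pi\<close>.
\<close>

definition v_profile :: "real \<Rightarrow> real \<Rightarrow> real" where
  "v_profile \<beta> = (THE v. periodic_solution \<beta> v)"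

text \<open>
  By \<open>pi\<close>-periodicity of the profile any branch of the polar angle gives the same function; we
  use the principal one. The value at the origin, where the mathematical function is
  undefined, is irrelevant.
\<close>

definition P_fun :: "real \<Rightarrow> real \<times> real \<Rightarrow> real" where
  "P_fun \<beta> x =
     v_profile \<beta> (Arg (Complex (fst x) (snd x))) / ((fst x)\<^sup>2 + (snd x)\<^sup>2) powr (3 / 2)"

definition K_fun :: "real \<Rightarrow> real \<times> real \<Rightarrow> real" where
  "K_fun \<beta> y = 9 * P_fun \<beta> (fst y / sqrt \<beta>, snd y)"

end

theory Submission
  imports Defs "HOL-Probability.Probability"
begin

text \<open>
  Restricted to the lines \<open>y\<^sub>2 = \<sigma> y\<^sub>1\<close>, the kernel is \<open>K (t, t \<sigma>) = h'' \<sigma> / \<bar>t\<bar>\<^sup>3\<close> with \<open>h\<close> the restriction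
  \<open>\<sigma> \<mapsto> (1 + \<sigma>\<^sup>2) powr (3/2) / (1 + \<beta> \<sigma>\<^sup>2)\<close> of the symbol \<open>m\<close> to the line \<open>{(- \<sigma>, 1)}\<close>. So \<open>v\<close> and \<open>K\<close> are explicit,
  and the two differential equations become polynomial identities. In the coordinates \<open>(t, \<sigma>)\<close> the
  integral of \<open>(1 - cos (k \<bullet> y)) * K y\<close> factors: the integral of \<open>(1 - cos (a t)) / t\<^sup>2\<close> is \<open>pi * \<bar>a\<bar>\<close>, and
  integrating \<open>pi * \<bar>k\<^sub>1 + \<sigma> k\<^sub>2\<bar> * h'' \<sigma>\<close> by parts gives \<open>2 * pi * m k\<close>. The formula for the operator
  then follows from Fubini and Fourier inversion.
\<close>

section \<open>The profile and the kernel in closed form\<close>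

text \<open>Why \<open>h''\<close> appears: \<open>m\<close> is even and homogeneous of degree 1, so
  off the line \<open>k_2 = 0\<close> it is recovered from \<open>h\<close> by scaling with
  \<open>\<bar>k_2\<bar>\<close>. The second derivative of \<open>\<bar>\<sigma> - a\<bar>\<close>
  is twice the point mass at \<open>a\<close>, so pairing \<open>\<bar>\<sigma> - a\<bar>\<close>
  with \<open>h''\<close> returns \<open>2 * h a\<close>, and \<open>a = - k_1 / k_2\<close> leads
  back to \<open>m k\<close>. This dictates the values of \<open>K\<close> on the points
  \<open>(1, \<sigma>)\<close>, and homogeneity of degree -3 dictates the rest. Three obstacles
  shape the argument. \<open>K\<close> is not integrable at the origin; only the second-order zero
  of \<open>1 - cos (k \<bullet> y)\<close> compensates. \<open>K\<close> takes both signs when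
  \<beta> < 2/3 or \<beta> > 3/2, so absolute convergence needs a separate bound for
  \<open>\<bar>K\<bar>\<close>. The boundary terms at infinity of the integration by parts do not
  vanish in general; they cancel between the two ends.\<close>

definition profile_numerator :: "real \<Rightarrow> real \<Rightarrow> real" where
  "profile_numerator \<beta> \<theta> = (3*\<beta> - 2) * sin \<theta> ^ 4 + (6 - 10*\<beta> + 6*\<beta>\<^sup>2) * (sin \<theta>)\<^sup>2 * (cos \<theta>)\<^sup>2
     + (3 - 2*\<beta>) * \<beta> * cos \<theta> ^ 4"

text \<open>This is \<open>K (sqrt \<beta> * cos \<theta>, sin \<theta>) / 9\<close>, obtained by
  solving \<open>K y = 9 * P (y_1 / sqrt \<beta>, y_2)\<close> for \<open>P\<close> on the unit
  circle. At these points the factor \<open>y_1^2 + \<beta> * y_2^2\<close> of the denominator of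
  \<open>K\<close> is the constant \<beta>, so only one inverse square root remains.\<close>

definition profile :: "real \<Rightarrow> real \<Rightarrow> real" where
  "profile \<beta> \<theta> = profile_numerator \<beta> \<theta> / (9 * \<beta>\<^sup>2) * (\<beta> * (cos \<theta>)\<^sup>2 + (sin \<theta>)\<^sup>2) powr (-1/2)"

lemma ellipse_pos: "0 < \<beta> \<Longrightarrow> 0 < \<beta> * (cos \<theta>)\<^sup>2 + (sin \<theta>)\<^sup>2" for \<beta> \<theta> :: real
  by (cases "cos \<theta> = 0") (use sin_cos_squared_add[of \<theta>] in \<open>auto intro: add_pos_nonneg\<close>)

lemma periodic_solution_profile:
  assumes "\<beta> > 0"
  shows "periodic_solution \<beta> (profile \<beta>)"
proof -
  define D where "D = (\<lambda>\<theta>. \<beta> * (cos \<theta>)\<^sup>2 + (sin \<theta>)\<^sup>2)"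
  define D1 where "D1 = (\<lambda>\<theta>. 2 * (1 - \<beta>) * sin \<theta> * cos \<theta>)"
  define D2 where "D2 = (\<lambda>\<theta>. 2 * (1 - \<beta>) * ((cos \<theta>)\<^sup>2 - (sin \<theta>)\<^sup>2))"
  define T where "T = profile_numerator \<beta>"
  define M where "M = 6 - 10*\<beta> + 6*\<beta>\<^sup>2"
  define T1 where "T1 = (\<lambda>\<theta>. 4 * (3*\<beta> - 2) * sin \<theta> ^ 3 * cos \<theta>
     + M * (2 * sin \<theta> * cos \<theta> ^ 3 - 2 * sin \<theta> ^ 3 * cos \<theta>) - 4 * (3 - 2*\<beta>) * \<beta> * cos \<theta> ^ 3 * sin \<theta>)"
  define T2 where "T2 = (\<lambda>\<theta>. 4 * (3*\<beta> - 2) * (3 * (sin \<theta>)\<^sup>2 * (cos \<theta>)\<^sup>2 - sin \<theta> ^ 4)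
     + M * (2 * cos \<theta> ^ 4 - 12 * (sin \<theta>)\<^sup>2 * (cos \<theta>)\<^sup>2 + 2 * sin \<theta> ^ 4)
     - 4 * (3 - 2*\<beta>) * \<beta> * (cos \<theta> ^ 4 - 3 * (cos \<theta>)\<^sup>2 * (sin \<theta>)\<^sup>2))"
  have Dpos: "D \<theta> > 0" for \<theta>
    using ellipse_pos[OF assms] by (simp add: D_def)
  have dD: "(D has_real_derivative D1 \<theta>) (at \<theta>)" for \<theta>
    unfolding D_def D1_def by (auto intro!: derivative_eq_intros simp: algebra_simps power2_eq_square)
  have dD1: "(D1 has_real_derivative D2 \<theta>) (at \<theta>)" for \<theta>
    unfolding D1_def D2_def by (auto intro!: derivative_eq_intros simp: algebra_simps power2_eq_square)
  have dT: "(T has_real_derivative T1 \<theta>) (at \<theta>)" for \<theta>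
    unfolding T_def profile_numerator_def[abs_def] M_def[symmetric] T1_def
    by (auto intro!: derivative_eq_intros simp: algebra_simps power2_eq_square power3_eq_cube)
  have dT1: "(T1 has_real_derivative T2 \<theta>) (at \<theta>)" for \<theta>
    unfolding T1_def T2_def
    by (auto intro!: derivative_eq_intros simp: algebra_simps power2_eq_square power3_eq_cube power4_eq_xxxx)
  have dpowr: "((\<lambda>\<theta>. D \<theta> powr a) has_real_derivative a * D \<theta> powr (a - 1) * D1 \<theta>) (at \<theta>)" for \<theta> a
    using DERIV_fun_powr[OF dD Dpos, of a \<theta>] by (simp add: mult_ac)
  define c where "c = 1 / (9 * \<beta>\<^sup>2)"
  define v1 where "v1 = (\<lambda>\<theta>. c * (T1 \<theta> * D \<theta> powr (-1/2) + T \<theta> * (-1/2 * D \<theta> powr (-3/2) * D1 \<theta>)))"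
  define v2 where "v2 = (\<lambda>\<theta>. c * (T2 \<theta> * D \<theta> powr (-1/2) + T1 \<theta> * (-1/2 * D \<theta> powr (-3/2) * D1 \<theta>)
     + (T1 \<theta> * (-1/2 * D \<theta> powr (-3/2) * D1 \<theta>)
       + T \<theta> * (-1/2 * ((-3/2 * D \<theta> powr (-5/2) * D1 \<theta>) * D1 \<theta> + D \<theta> powr (-3/2) * D2 \<theta>)))))"
  have v: "profile \<beta> = (\<lambda>\<theta>. c * (T \<theta> * D \<theta> powr (-1/2)))"
    by (auto simp: profile_def c_def T_def D_def)
  have dv: "(profile \<beta> has_real_derivative v1 \<theta>) (at \<theta>)" for \<theta>
    unfolding v v1_def
    by (rule derivative_eq_intros dT dpowr refl | simp add: algebra_simps)+
  have dv1: "(v1 has_real_derivative v2 \<theta>) (at \<theta>)" for \<theta>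
    unfolding v1_def v2_def
    by (rule derivative_eq_intros dT dT1 dD1 dpowr refl | simp add: algebra_simps)+
  \<comment> \<open>The factor left of \<open>v'' + 9 * v\<close> once
    \<open>c * D \<theta> powr (-5/2)\<close> is taken out; it has to be the constant
    \<open>1 / c\<close>.\<close>
  have key: "T2 \<theta> * (D \<theta>)\<^sup>2 - T1 \<theta> * D1 \<theta> * D \<theta> - T \<theta> * D2 \<theta> * D \<theta> / 2 + 3/4 * T \<theta> * (D1 \<theta>)\<^sup>2
      + 9 * T \<theta> * (D \<theta>)\<^sup>2 = 9 * \<beta>\<^sup>2" for \<theta>
  proof -
    \<comment> \<open>The fourth power of \<open>sin^2 + cos^2\<close> makes both sides homogeneous
      of degree 8 in sine and cosine. The identity then holds between polynomials, without the
      Pythagorean relation.\<close>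
    have "T2 \<theta> * (D \<theta>)\<^sup>2 - T1 \<theta> * D1 \<theta> * D \<theta> - T \<theta> * D2 \<theta> * D \<theta> / 2 + 3/4 * T \<theta> * (D1 \<theta>)\<^sup>2
      + 9 * T \<theta> * (D \<theta>)\<^sup>2 = 9 * \<beta>\<^sup>2 * ((sin \<theta>)\<^sup>2 + (cos \<theta>)\<^sup>2) ^ 4"
      unfolding T2_def T1_def T_def profile_numerator_def D_def D1_def D2_def M_def
      by algebra
    then show ?thesis by simp
  qed
  have ode: "v2 \<theta> + 9 * profile \<beta> \<theta> = D \<theta> powr (-5/2)" for \<theta>
  proof -
    have p1: "D \<theta> powr (-1/2) = D \<theta> powr (-5/2) * (D \<theta>)\<^sup>2"
      using Dpos[of \<theta>] powr_add[of "D \<theta>" "-5/2" 2] by (simp add: powr_numeral)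
    have p2: "D \<theta> powr (-3/2) = D \<theta> powr (-5/2) * D \<theta>"
      using Dpos[of \<theta>] powr_add[of "D \<theta>" "-5/2" 1] by simp
    have "v2 \<theta> + 9 * profile \<beta> \<theta> = c * D \<theta> powr (-5/2) *
       (T2 \<theta> * (D \<theta>)\<^sup>2 - T1 \<theta> * D1 \<theta> * D \<theta> - T \<theta> * D2 \<theta> * D \<theta> / 2 + 3/4 * T \<theta> * (D1 \<theta>)\<^sup>2
      + 9 * T \<theta> * (D \<theta>)\<^sup>2)"
      unfolding v v2_def p1 p2 by (simp add: algebra_simps power2_eq_square)
    also have "\<dots> = D \<theta> powr (-5/2)"
      unfolding key c_def using assms by simp
    finally show ?thesis .
  qed
  show ?thesis
    unfolding periodic_solution_def
  proof (intro conjI exI allI)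
    show "profile \<beta> (\<theta> + pi) = profile \<beta> \<theta>" for \<theta>
      by (simp add: profile_def profile_numerator_def)
    show "v2 \<theta> + 9 * profile \<beta> \<theta> = (\<beta> * (cos \<theta>)\<^sup>2 + (sin \<theta>)\<^sup>2) powr (- 5 / 2)" for \<theta>
      using ode[of \<theta>] by (simp add: D_def)
  qed (rule dv dv1)+
qed

lemma periodic_solution_unique:
  assumes "periodic_solution \<beta> v" "periodic_solution \<beta> w"
  shows "v = w"
proof -
  obtain v1 v2 where v: "\<And>\<theta>. v (\<theta> + pi) = v \<theta>" "\<And>\<theta>. (v has_real_derivative v1 \<theta>) (at \<theta>)"
      "\<And>\<theta>. (v1 has_real_derivative v2 \<theta>) (at \<theta>)"
      "\<And>\<theta>. v2 \<theta> + 9 * v \<theta> = (\<beta> * (cos \<theta>)\<^sup>2 + (sin \<theta>)\<^sup>2) powr (- 5 / 2)"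
    using assms(1) unfolding periodic_solution_def by auto
  obtain w1 w2 where w: "\<And>\<theta>. w (\<theta> + pi) = w \<theta>" "\<And>\<theta>. (w has_real_derivative w1 \<theta>) (at \<theta>)"
      "\<And>\<theta>. (w1 has_real_derivative w2 \<theta>) (at \<theta>)"
      "\<And>\<theta>. w2 \<theta> + 9 * w \<theta> = (\<beta> * (cos \<theta>)\<^sup>2 + (sin \<theta>)\<^sup>2) powr (- 5 / 2)"
    using assms(2) unfolding periodic_solution_def by auto
  define f where "f = (\<lambda>\<theta>. v \<theta> - w \<theta>)"
  define f1 where "f1 = (\<lambda>\<theta>. v1 \<theta> - w1 \<theta>)"
  have f: "(f has_real_derivative f1 \<theta>) (at \<theta>)" and f1: "(f1 has_real_derivative - 9 * f \<theta>) (at \<theta>)" for \<theta>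
    using v(4)[of \<theta>] w(4)[of \<theta>] unfolding f_def f1_def
    by (auto intro!: derivative_eq_intros v(2,3) w(2,3))
  have per: "f (\<theta> + pi) = f \<theta>" for \<theta>
    by (simp add: f_def v w)
  have per1: "f1 (\<theta> + pi) = f1 \<theta>" for \<theta>
  proof (rule DERIV_unique)
    \<comment> \<open>\<open>f\<close> equals its own translate by \<open>pi\<close>, so its
      derivative at \<theta> can also be computed at \<open>\<theta> + pi\<close>.\<close>
    show "(f has_real_derivative f1 (\<theta> + pi)) (at \<theta>)"
      using f[of "\<theta> + pi"] per by (simp add: DERIV_shift[of f _ \<theta> pi])
  qed (rule f)
  \<comment> \<open>First integrals of \<open>f'' = - 9 f\<close>; for \<open>pi\<close>-periodic \<open>f\<close> they change sign under a shift by \<open>pi\<close>.\<close>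
  define A where "A = (\<lambda>\<theta>. 3 * f \<theta> * cos (3*\<theta>) - f1 \<theta> * sin (3*\<theta>))"
  define B where "B = (\<lambda>\<theta>. 3 * f \<theta> * sin (3*\<theta>) + f1 \<theta> * cos (3*\<theta>))"
  have "(A has_real_derivative 0) (at \<theta>)" "(B has_real_derivative 0) (at \<theta>)" for \<theta>
    unfolding A_def B_def
    by (auto intro!: derivative_eq_intros f f1 simp: algebra_simps)
  then have const: "A \<theta> = A (\<theta> + pi)" "B \<theta> = B (\<theta> + pi)" for \<theta>
    using DERIV_isconst_all by blast+
  have "sin (3 * \<theta> + 3 * pi) = - sin (3 * \<theta>)" "cos (3 * \<theta> + 3 * pi) = - cos (3 * \<theta>)" for \<theta> :: real
    using sin_add[of "3*\<theta>" "3*pi"] cos_add[of "3*\<theta>" "3*pi"] sin_npi[of 3] cos_npi[of 3] by auto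
  then have "A (\<theta> + pi) = - A \<theta>" "B (\<theta> + pi) = - B \<theta>" for \<theta>
    by (auto simp: A_def B_def per per1 distrib_left)
  with const have zero: "A \<theta> = 0" "B \<theta> = 0" for \<theta>
    by (metis neg_equal_zero)+
  have "f \<theta> = 0" for \<theta>
  proof -
    \<comment> \<open>The pair \<open>(A, B)\<close> is \<open>(3 * f, f1)\<close> rotated by the
      angle \<open>3 * \<theta>\<close>; rotating back recovers \<open>f\<close>.\<close>
    have "3 * f \<theta> = A \<theta> * cos (3*\<theta>) + B \<theta> * sin (3*\<theta>)"
    proof -
      have "A \<theta> * cos (3*\<theta>) + B \<theta> * sin (3*\<theta>) = 3 * f \<theta> * ((sin (3*\<theta>))\<^sup>2 + (cos (3*\<theta>))\<^sup>2)"
        unfolding A_def B_def by algebra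
      then show ?thesis by simp
    qed
    with zero show ?thesis by simp
  qed
  then show ?thesis by (auto simp: f_def)
qed

lemma v_profile_eq: "\<beta> > 0 \<Longrightarrow> v_profile \<beta> = profile \<beta>"
  unfolding v_profile_def
  by (rule the_equality) (auto intro: periodic_solution_profile periodic_solution_unique)

section \<open>Closed form of the kernel\<close>

text \<open>A quartic form with two roles: at \<open>(1, \<sigma>)\<close> it is the numerator of
  \<open>h''\<close>, and at \<open>(sqrt \<beta> * cos \<theta>, sin \<theta>)\<close> it is
  \<open>\<beta> * profile_numerator \<beta> \<theta>\<close>.\<close>

definition kernel_numerator :: "real \<Rightarrow> real \<Rightarrow> real \<Rightarrow> real" where
  "kernel_numerator \<beta> x y = (3*\<beta>\<^sup>2 - 2*\<beta>) * y ^ 4 + (6 - 10*\<beta> + 6*\<beta>\<^sup>2) * (x\<^sup>2 * y\<^sup>2) + (3 - 2*\<beta>) * x ^ 4"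

lemma K_fun_eq:
  assumes \<beta>: "\<beta> > 0"
  shows "K_fun \<beta> z = kernel_numerator \<beta> (fst z) (snd z) /
    (sqrt ((fst z)\<^sup>2 + (snd z)\<^sup>2) ^ 1 * ((fst z)\<^sup>2 + \<beta> * (snd z)\<^sup>2) ^ 3)"
proof (cases "z = 0")
  \<comment> \<open>Both sides are 0 at the origin, by division by 0 on the left and by the
    numerator on the right. Hence the closed form is an equation between functions on the whole
    plane, which measurability uses later.\<close>
  case True
  then show ?thesis by (simp add: K_fun_def P_fun_def kernel_numerator_def)
next
  case False
  obtain x y where z: "z = (x, y)" by fastforce
  with False have nz: "x \<noteq> 0 \<or> y \<noteq> 0" by (auto simp: zero_prod_def)
  define s where "s = sqrt \<beta>"
  have s: "s > 0" "s\<^sup>2 = \<beta>" using \<beta> by (auto simp: s_def)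
  \<comment> \<open>Polar coordinates of the rescaled point \<open>(x / sqrt \<beta>, y)\<close> at
    which \<open>P_fun\<close> is evaluated. They turn
    \<open>x\<^sup>2 + \<beta> * y\<^sup>2\<close> into \<open>\<beta> * r\<^sup>2\<close> and
    \<open>x\<^sup>2 + y\<^sup>2\<close> into \<open>r\<^sup>2 * D\<close>.\<close>
  define r where "r = cmod (Complex (x / s) y)"
  have r2: "r\<^sup>2 = (x\<^sup>2 + \<beta> * y\<^sup>2) / \<beta>"
    using s \<beta> by (simp add: r_def cmod_power2 power_divide divide_simps)
  have rpos: "r > 0" using nz s by (auto simp: r_def complex_eq_iff)
  define \<theta> where "\<theta> = Arg (Complex (x / s) y)"
  have "Complex (x / s) y = r * exp (\<i> * \<theta>)"
    using Arg_eq[of "Complex (x / s) y"] nz s by (auto simp: r_def \<theta>_def complex_eq_iff)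
  then have "Re (Complex (x / s) y) = Re (r * exp (\<i> * \<theta>))" "Im (Complex (x / s) y) = Im (r * exp (\<i> * \<theta>))"
    by simp_all
  then have xy: "x = s * r * cos \<theta>" "y = r * sin \<theta>"
    using s by (simp_all add: Re_exp Im_exp field_simps)
  define Q where "Q = x\<^sup>2 + \<beta> * y\<^sup>2"
  have Q: "Q = \<beta> * r\<^sup>2" using r2 \<beta> by (simp add: Q_def)
  define D where "D = \<beta> * (cos \<theta>)\<^sup>2 + (sin \<theta>)\<^sup>2"
  have Dpos: "D > 0" using ellipse_pos[OF \<beta>] by (simp add: D_def)
  have n: "x\<^sup>2 + y\<^sup>2 = r\<^sup>2 * D"
    unfolding xy D_def s(2)[symmetric] by algebra
  have n': "sqrt (x\<^sup>2 + y\<^sup>2) = r * sqrt D"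
    unfolding n using rpos by (simp add: real_sqrt_mult)
  have r': "(x / s)\<^sup>2 + y\<^sup>2 = r\<^sup>2" by (simp add: r_def cmod_power2)
  have p3: "(r\<^sup>2) powr (3/2) = r ^ 3"
    using powr_powr[of r 2 "3/2"] rpos by (simp add: powr_numeral)
  have pD: "D powr (-1/2) = 1 / sqrt D"
    using powr_minus[of D "1/2"] powr_half_sqrt[of D] Dpos by (simp add: inverse_eq_divide)
  have N: "kernel_numerator \<beta> x y = \<beta> * r ^ 4 * profile_numerator \<beta> \<theta>"
    unfolding kernel_numerator_def profile_numerator_def xy s(2)[symmetric] by algebra
  have "K_fun \<beta> z = 9 * (profile \<beta> \<theta> / ((x/s)\<^sup>2 + y\<^sup>2) powr (3/2))"
    by (simp add: K_fun_def P_fun_def v_profile_eq[OF \<beta>] z \<theta>_def s_def)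
  also have "\<dots> = profile_numerator \<beta> \<theta> / (\<beta>\<^sup>2 * sqrt D * r ^ 3)"
    unfolding r' p3 profile_def D_def[symmetric] pD by simp
  also have "\<dots> = \<beta> * r ^ 4 * profile_numerator \<beta> \<theta> / ((r * sqrt D) ^ 1 * (\<beta> * r\<^sup>2) ^ 3)"
  proof -
    have *: "(r * sqrt D) ^ 1 * (\<beta> * r\<^sup>2) ^ 3 = \<beta> * r ^ 4 * (\<beta>\<^sup>2 * sqrt D * r ^ 3)"
      by algebra
    show ?thesis
      unfolding * using rpos \<beta> by simp
  qed
  also have "\<dots> = kernel_numerator \<beta> x y / (sqrt (x\<^sup>2 + y\<^sup>2) ^ 1 * Q ^ 3)"
    unfolding N n' Q ..
  finally show ?thesis by (simp add: z Q_def)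
qed

section \<open>Partial derivatives of the kernel and its equation off the origin\<close>

lemma DERIV_quotient_sqrt_quadratic:
  fixes A :: "real \<Rightarrow> real"
  assumes A: "(A has_real_derivative A') (at t)" and R: "t\<^sup>2 + c > 0" and Q: "p * t\<^sup>2 + d > 0"
  shows "((\<lambda>t. A t / (sqrt (t\<^sup>2 + c) ^ i * (p * t\<^sup>2 + d) ^ j)) has_real_derivative
    (A' * (t\<^sup>2 + c) * (p * t\<^sup>2 + d) - i * A t * t * (p * t\<^sup>2 + d) - 2 * j * p * t * A t * (t\<^sup>2 + c))
      / (sqrt (t\<^sup>2 + c) ^ (i + 2) * (p * t\<^sup>2 + d) ^ (j + 1))) (at t)"
proof -
  define \<rho> where "\<rho> = sqrt (t\<^sup>2 + c)"
  have \<rho>: "\<rho> > 0" "t\<^sup>2 + c = \<rho>\<^sup>2" using R by (auto simp: \<rho>_def)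
  have d\<rho>: "((\<lambda>t. sqrt (t\<^sup>2 + c)) has_real_derivative t / \<rho>) (at t)"
    unfolding \<rho>_def using R by (auto intro!: derivative_eq_intros simp: field_simps)
  \<comment> \<open>Dividing by \<open>f t\<close> instead of lowering the exponent avoids the
    truncated \<open>n - 1\<close> at \<open>n = 0\<close>.\<close>
  have dpow: "((\<lambda>t. f t ^ n) has_real_derivative n * f t ^ n * f' / f t) (at t)"
    if "(f has_real_derivative f') (at t)" "f t \<noteq> 0" for f :: "real \<Rightarrow> real" and f' and n :: nat
    by (rule DERIV_cong[OF DERIV_power[OF that(1)]]) (use that(2) in \<open>cases n; simp add: field_simps\<close>)
  have dQ: "((\<lambda>t. p * t\<^sup>2 + d) has_real_derivative 2 * p * t) (at t)"
    by (auto intro!: derivative_eq_intros)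
  have d1: "((\<lambda>t. sqrt (t\<^sup>2 + c) ^ i) has_real_derivative i * \<rho> ^ i * (t / \<rho>) / \<rho>) (at t)"
    using dpow[OF d\<rho>, of i] \<rho>(1) unfolding \<rho>_def[symmetric] by simp
  have d2: "((\<lambda>t. (p * t\<^sup>2 + d) ^ j) has_real_derivative
     j * (p * t\<^sup>2 + d) ^ j * (2 * p * t) / (p * t\<^sup>2 + d)) (at t)"
    using dpow[OF dQ, of j] Q by simp
  have e: "(A' * (\<rho> ^ i * q ^ j) - A t * (i * \<rho> ^ i * (t / \<rho>) / \<rho> * q ^ j
       + j * q ^ j * (2 * p * t) / q * \<rho> ^ i)) / ((\<rho> ^ i * q ^ j) * (\<rho> ^ i * q ^ j))
     = (A' * \<rho>\<^sup>2 * q - i * A t * t * q - 2 * j * p * t * A t * \<rho>\<^sup>2) / (\<rho> ^ (i + 2) * q ^ (j + 1))"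
    if "q > 0" for q :: real
  proof -
    have *: "(A' * (a * b) - A t * (i * a * (t / \<rho>) / \<rho> * b + j * b * (2 * p * t) / q * a)) / ((a * b) * (a * b))
       = (A' * \<rho>\<^sup>2 * q - i * A t * t * q - 2 * j * p * t * A t * \<rho>\<^sup>2) / (a * \<rho>\<^sup>2 * (b * q))"
      if "a > 0" "b > 0" for a b :: real
      using that \<rho>(1) \<open>q > 0\<close> by (simp add: field_simps power2_eq_square)
    show ?thesis
      using *[of "\<rho> ^ i" "q ^ j"] that \<rho>(1) by (simp add: power_add) (simp add: power2_eq_square)
  qed
  have "((\<lambda>t. A t / (sqrt (t\<^sup>2 + c) ^ i * (p * t\<^sup>2 + d) ^ j)) has_real_derivative
     (A' * (\<rho> ^ i * (p * t\<^sup>2 + d) ^ j) - A t * (i * \<rho> ^ i * (t / \<rho>) / \<rho> * (p * t\<^sup>2 + d) ^ j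
       + j * (p * t\<^sup>2 + d) ^ j * (2 * p * t) / (p * t\<^sup>2 + d) * \<rho> ^ i))
     / ((\<rho> ^ i * (p * t\<^sup>2 + d) ^ j) * (\<rho> ^ i * (p * t\<^sup>2 + d) ^ j))) (at t)"
    using DERIV_divide[OF A DERIV_mult[OF d1 d2]] \<rho>(1) Q unfolding \<rho>_def[symmetric] by simp
  then show ?thesis
    unfolding \<rho>(2) e[OF Q] \<rho>_def[symmetric] by (simp add: \<rho> abs_of_pos)
qed

text \<open>What the quotient rule makes of \<open>kernel_numerator\<close> for the exponents
  \<open>i = 1\<close>, \<open>j = 3\<close> of \<open>K\<close>; the coefficient 6 is
  \<open>2 * j\<close>. The factor in the first bracket is the derivative of
  \<open>kernel_numerator\<close> in its first variable.\<close>

definition numerator1 :: "real \<Rightarrow> real \<Rightarrow> real \<Rightarrow> real" where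
  "numerator1 \<beta> x y = (2 * (6 - 10*\<beta> + 6*\<beta>\<^sup>2) * (x * y\<^sup>2) + 4 * (3 - 2*\<beta>) * x ^ 3) * (x\<^sup>2 + y\<^sup>2) * (x\<^sup>2 + \<beta> * y\<^sup>2)
    - kernel_numerator \<beta> x y * x * (x\<^sup>2 + \<beta> * y\<^sup>2) - 6 * x * kernel_numerator \<beta> x y * (x\<^sup>2 + y\<^sup>2)"

definition numerator2 :: "real \<Rightarrow> real \<Rightarrow> real \<Rightarrow> real" where
  "numerator2 \<beta> x y = (4 * (3*\<beta>\<^sup>2 - 2*\<beta>) * y ^ 3 + 2 * (6 - 10*\<beta> + 6*\<beta>\<^sup>2) * (x\<^sup>2 * y)) * (x\<^sup>2 + y\<^sup>2) * (x\<^sup>2 + \<beta> * y\<^sup>2)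
    - kernel_numerator \<beta> x y * y * (x\<^sup>2 + \<beta> * y\<^sup>2) - 6 * \<beta> * y * kernel_numerator \<beta> x y * (x\<^sup>2 + y\<^sup>2)"

definition kernel_quotient :: "real \<Rightarrow> (real \<Rightarrow> real \<Rightarrow> real) \<Rightarrow> nat \<Rightarrow> nat \<Rightarrow> real \<times> real \<Rightarrow> real" where
  "kernel_quotient \<beta> A i j z = A (fst z) (snd z) /
    (sqrt ((fst z)\<^sup>2 + (snd z)\<^sup>2) ^ i * ((fst z)\<^sup>2 + \<beta> * (snd z)\<^sup>2) ^ j)"

lemma quadratic_pos:
  assumes "\<beta> > 0" "z \<noteq> 0"
  shows "(fst z)\<^sup>2 + \<beta> * (snd z)\<^sup>2 > (0::real)"
proof -
  have "fst z \<noteq> 0 \<or> snd z \<noteq> 0" using assms(2) by (auto simp: prod_eq_iff)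
  then show ?thesis using assms(1)
    by (metis add_nonneg_pos add_pos_nonneg mult_nonneg_nonneg mult_pos_pos less_imp_le zero_le_power2 zero_less_power2)
qed

lemma partial1_kernel_quotient:
  assumes "\<beta> > 0" "z \<noteq> 0"
    and "((\<lambda>t. A t (snd z)) has_real_derivative A') (at (fst z))"
  shows "partial1 (kernel_quotient \<beta> A i j) z =
    (A' * ((fst z)\<^sup>2 + (snd z)\<^sup>2) * ((fst z)\<^sup>2 + \<beta> * (snd z)\<^sup>2) - i * A (fst z) (snd z) * fst z * ((fst z)\<^sup>2 + \<beta> * (snd z)\<^sup>2)
       - 2 * j * fst z * A (fst z) (snd z) * ((fst z)\<^sup>2 + (snd z)\<^sup>2))
      / (sqrt ((fst z)\<^sup>2 + (snd z)\<^sup>2) ^ (i + 2) * ((fst z)\<^sup>2 + \<beta> * (snd z)\<^sup>2) ^ (j + 1))"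
  unfolding partial1_def kernel_quotient_def
  using DERIV_quotient_sqrt_quadratic[OF assms(3), where c="(snd z)\<^sup>2" and p=1 and d="\<beta> * (snd z)\<^sup>2" and i=i and j=j]
    quadratic_pos[OF assms(1,2)] quadratic_pos[OF _ assms(2), of 1]
  by (simp add: has_real_derivative_iff_has_vector_derivative vector_derivative_at)

lemma partial2_kernel_quotient:
  assumes "\<beta> > 0" "z \<noteq> 0"
    and "((\<lambda>t. A (fst z) t) has_real_derivative A') (at (snd z))"
  shows "partial2 (kernel_quotient \<beta> A i j) z =
    (A' * ((fst z)\<^sup>2 + (snd z)\<^sup>2) * ((fst z)\<^sup>2 + \<beta> * (snd z)\<^sup>2) - i * A (fst z) (snd z) * snd z * ((fst z)\<^sup>2 + \<beta> * (snd z)\<^sup>2)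
       - 2 * j * \<beta> * snd z * A (fst z) (snd z) * ((fst z)\<^sup>2 + (snd z)\<^sup>2))
      / (sqrt ((fst z)\<^sup>2 + (snd z)\<^sup>2) ^ (i + 2) * ((fst z)\<^sup>2 + \<beta> * (snd z)\<^sup>2) ^ (j + 1))"
  unfolding partial2_def kernel_quotient_def
  using DERIV_quotient_sqrt_quadratic[OF assms(3), where c="(fst z)\<^sup>2" and p=\<beta> and d="(fst z)\<^sup>2" and i=i and j=j]
    quadratic_pos[OF assms(1,2)] quadratic_pos[OF _ assms(2), of 1]
  by (simp add: has_real_derivative_iff_has_vector_derivative vector_derivative_at add.commute)

lemma differentiable_kernel_quotient:
  assumes "\<beta> > 0" "z \<noteq> 0" "(\<lambda>z. A (fst z) (snd z)) differentiable (at z)"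
  shows "kernel_quotient \<beta> A i j differentiable (at z)"
proof -
  have q: "(fst z)\<^sup>2 + \<beta> * (snd z)\<^sup>2 > 0" "(fst z)\<^sup>2 + (snd z)\<^sup>2 > 0"
    using quadratic_pos[OF assms(1,2)] quadratic_pos[OF _ assms(2), of 1] by simp_all
  have f: "(\<lambda>z::real\<times>real. fst z) differentiable (at z)" "(\<lambda>z::real\<times>real. snd z) differentiable (at z)"
    by (auto intro!: bounded_linear_imp_differentiable bounded_linear_fst bounded_linear_snd)
  have "(\<lambda>z. (fst z)\<^sup>2 + (snd z)\<^sup>2 :: real) differentiable (at z)"
    using f by simp
  then obtain D where "((\<lambda>z. (fst z)\<^sup>2 + (snd z)\<^sup>2 :: real) has_derivative D) (at z)"
    by (auto simp: differentiable_def)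
  from has_derivative_real_sqrt[OF q(2) this]
  have "(\<lambda>z. sqrt ((fst z)\<^sup>2 + (snd z)\<^sup>2)) differentiable (at z)"
    by (auto simp: differentiable_def)
  then show ?thesis
    unfolding kernel_quotient_def[abs_def]
    using f assms(3) q by (intro differentiable_divide differentiable_mult differentiable_power
        differentiable_add differentiable_const) auto
qed

lemma differentiable_transform_nonzero:
  fixes f g :: "real \<times> real \<Rightarrow> real"
  assumes "\<And>w. w \<noteq> 0 \<Longrightarrow> f w = g w" "g differentiable (at z)" "z \<noteq> 0"
  shows "f differentiable (at z)"
proof -
  obtain D where "(g has_derivative D) (at z)" using assms(2) by (auto simp: differentiable_def)
  then have "(f has_derivative D) (at z)"
    by (rule has_derivative_transform_within_open[where s="-{0}"]) (use assms in auto)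
  then show ?thesis by (auto simp: differentiable_def)
qed

lemma K_fun_kernel_quotient: "\<beta> > 0 \<Longrightarrow> K_fun \<beta> = kernel_quotient \<beta> (kernel_numerator \<beta>) 1 3"
  unfolding fun_eq_iff K_fun_eq kernel_quotient_def by simp

lemma partial1_K_fun:
  assumes "\<beta> > 0" "z \<noteq> 0"
  shows "partial1 (K_fun \<beta>) z = kernel_quotient \<beta> (numerator1 \<beta>) 3 4 z"
proof -
  have "((\<lambda>t. kernel_numerator \<beta> t (snd z)) has_real_derivative
      2 * (6 - 10*\<beta> + 6*\<beta>\<^sup>2) * (fst z * (snd z)\<^sup>2) + 4 * (3 - 2*\<beta>) * fst z ^ 3) (at (fst z))"
    unfolding kernel_numerator_def by (auto intro!: derivative_eq_intros simp: algebra_simps)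
  from partial1_kernel_quotient[where A="kernel_numerator \<beta>", OF assms this, of 1 3] show ?thesis
    unfolding K_fun_kernel_quotient[OF assms(1)] by (simp add: kernel_quotient_def[of _ "numerator1 \<beta>"] numerator1_def del: One_nat_def)
qed

lemma partial2_K_fun:
  assumes "\<beta> > 0" "z \<noteq> 0"
  shows "partial2 (K_fun \<beta>) z = kernel_quotient \<beta> (numerator2 \<beta>) 3 4 z"
proof -
  have "((\<lambda>t. kernel_numerator \<beta> (fst z) t) has_real_derivative
      4 * (3*\<beta>\<^sup>2 - 2*\<beta>) * snd z ^ 3 + 2 * (6 - 10*\<beta> + 6*\<beta>\<^sup>2) * ((fst z)\<^sup>2 * snd z)) (at (snd z))"
    unfolding kernel_numerator_def by (auto intro!: derivative_eq_intros simp: algebra_simps)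
  from partial2_kernel_quotient[where A="kernel_numerator \<beta>", OF assms this, of 1 3] show ?thesis
    unfolding K_fun_kernel_quotient[OF assms(1)] by (simp add: kernel_quotient_def[of _ "numerator2 \<beta>"] numerator2_def del: One_nat_def)
qed

text \<open>The closed forms of the first partial derivatives are available only off the origin, so
  differentiating them again needs a local argument. The horizontal line through \<open>z\<close>
  meets the origin only if \<open>snd z = 0\<close>, and then \<open>t \<noteq> 0\<close> for all
  \<open>t\<close> near \<open>fst z\<close>.\<close>

lemma partial1_cong:
  assumes "\<And>w. w \<noteq> 0 \<Longrightarrow> f w = g w" "z \<noteq> 0"
  shows "partial1 f z = partial1 g z"
proof -
  have "\<forall>\<^sub>F t in nhds (fst z). f (t, snd z) = g (t, snd z)"
  proof (cases "snd z = 0")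
    case True
    then have "fst z \<noteq> 0" using assms(2) by (auto simp: prod_eq_iff)
    then have "\<forall>\<^sub>F t in nhds (fst z). t \<noteq> 0" by (rule t1_space_nhds)
    then show ?thesis by eventually_elim (auto intro!: assms simp: zero_prod_def)
  qed (auto intro!: always_eventually assms simp: zero_prod_def)
  then show ?thesis unfolding partial1_def
    by (intro vector_derivative_cong_eq) (auto elim: eventually_mono)
qed

lemma partial2_cong:
  assumes "\<And>w. w \<noteq> 0 \<Longrightarrow> f w = g w" "z \<noteq> 0"
  shows "partial2 f z = partial2 g z"
proof -
  have "\<forall>\<^sub>F t in nhds (snd z). f (fst z, t) = g (fst z, t)"
  proof (cases "fst z = 0")
    case True
    then have "snd z \<noteq> 0" using assms(2) by (auto simp: prod_eq_iff)
    then have "\<forall>\<^sub>F t in nhds (snd z). t \<noteq> 0" by (rule t1_space_nhds)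
    then show ?thesis by eventually_elim (auto intro!: assms simp: zero_prod_def)
  qed (auto intro!: always_eventually assms simp: zero_prod_def)
  then show ?thesis unfolding partial2_def
    by (intro vector_derivative_cong_eq) (auto elim: eventually_mono)
qed

lemma K_fun_pde:
  assumes \<beta>: "\<beta> > 0" and z: "z \<noteq> 0"
  shows "\<beta> * partial1 (partial1 (K_fun \<beta>)) z + partial2 (partial2 (K_fun \<beta>)) z = 9 / norm z ^ 5"
proof -
  obtain x y where xy: "z = (x, y)" by fastforce
  define R Q S M N1 N2 where "R = x\<^sup>2 + y\<^sup>2" and "Q = x\<^sup>2 + \<beta> * y\<^sup>2" and "S = kernel_numerator \<beta> x y"
    and "M = 6 - 10*\<beta> + 6*\<beta>\<^sup>2" and "N1 = numerator1 \<beta> x y" and "N2 = numerator2 \<beta> x y"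
  define Sx Sxx Sy Syy where "Sx = 2 * M * (x * y\<^sup>2) + 4 * (3 - 2*\<beta>) * x ^ 3"
    and "Sxx = 2 * M * y\<^sup>2 + 12 * (3 - 2*\<beta>) * x\<^sup>2"
    and "Sy = 4 * (3*\<beta>\<^sup>2 - 2*\<beta>) * y ^ 3 + 2 * M * (x\<^sup>2 * y)"
    and "Syy = 12 * (3*\<beta>\<^sup>2 - 2*\<beta>) * y\<^sup>2 + 2 * M * x\<^sup>2"
  note defs = R_def Q_def S_def M_def Sx_def Sxx_def Sy_def Syy_def
  define D1 where "D1 = Sxx * R * Q + Sx * (2 * x) * Q + Sx * R * (2 * x)
     - (Sx * x * Q + S * Q + S * x * (2 * x)) - 6 * (S * R + x * Sx * R + x * S * (2 * x))"
  define D2 where "D2 = Syy * R * Q + Sy * (2 * y) * Q + Sy * R * (2 * \<beta> * y)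
     - (Sy * y * Q + S * Q + S * y * (2 * \<beta> * y)) - 6 * \<beta> * (S * R + y * Sy * R + y * S * (2 * y))"
  have dS1: "((\<lambda>t. kernel_numerator \<beta> t y) has_real_derivative Sx) (at x)"
    unfolding kernel_numerator_def Sx_def M_def by (auto intro!: derivative_eq_intros simp: algebra_simps)
  have dS2: "((\<lambda>t. kernel_numerator \<beta> x t) has_real_derivative Sy) (at y)"
    unfolding kernel_numerator_def Sy_def M_def by (auto intro!: derivative_eq_intros simp: algebra_simps)
  have d1: "((\<lambda>t. numerator1 \<beta> t y) has_real_derivative D1) (at x)"
    unfolding numerator1_def D1_def defs
    by (rule derivative_eq_intros dS1[unfolded defs] refl)+ (simp, algebra)
  have d2: "((\<lambda>t. numerator2 \<beta> x t) has_real_derivative D2) (at y)"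
    unfolding numerator2_def D2_def defs
    by (rule derivative_eq_intros dS2[unfolded defs] refl)+ (simp, algebra)
  have pos: "R > 0" "Q > 0"
    using quadratic_pos[OF \<beta> z] quadratic_pos[OF _ z, of 1] by (simp_all add: R_def Q_def xy)
  have c1: "partial1 (partial1 (K_fun \<beta>)) z = partial1 (kernel_quotient \<beta> (numerator1 \<beta>) 3 4) z"
    by (rule partial1_cong[OF _ z]) (rule partial1_K_fun[OF \<beta>])
  have e1: "partial1 (partial1 (K_fun \<beta>)) z = (D1 * R * Q - 3 * N1 * x * Q - 8 * x * N1 * R) / (sqrt R ^ 5 * Q ^ 5)"
    unfolding c1
    using partial1_kernel_quotient[OF \<beta> z, of "numerator1 \<beta>" D1 3 4] d1
    by (simp add: xy R_def Q_def N1_def)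
  have c2: "partial2 (partial2 (K_fun \<beta>)) z = partial2 (kernel_quotient \<beta> (numerator2 \<beta>) 3 4) z"
    by (rule partial2_cong[OF _ z]) (rule partial2_K_fun[OF \<beta>])
  have e2: "partial2 (partial2 (K_fun \<beta>)) z = (D2 * R * Q - 3 * N2 * y * Q - 8 * \<beta> * y * N2 * R) / (sqrt R ^ 5 * Q ^ 5)"
    unfolding c2
    using partial2_kernel_quotient[OF \<beta> z, of "numerator2 \<beta>" D2 3 4] d2
    by (simp add: xy R_def Q_def N2_def)
  \<comment> \<open>The whole equation is this identity between polynomials in \<open>x\<close>,
    \<open>y\<close> and \<beta>. The power \<open>Q ^ 5\<close> cancels against the common
    denominator \<open>sqrt R ^ 5 * Q ^ 5\<close>.\<close>
  have key: "\<beta> * (D1 * R * Q - 3 * N1 * x * Q - 8 * x * N1 * R) + (D2 * R * Q - 3 * N2 * y * Q - 8 * \<beta> * y * N2 * R)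
     = 9 * Q ^ 5"
    unfolding D1_def D2_def N1_def N2_def numerator1_def numerator2_def defs kernel_numerator_def
    by algebra
  have "\<beta> * partial1 (partial1 (K_fun \<beta>)) z + partial2 (partial2 (K_fun \<beta>)) z = 9 * Q ^ 5 / (sqrt R ^ 5 * Q ^ 5)"
    unfolding e1 e2 key[symmetric] by (simp add: add_divide_distrib)
  also have "\<dots> = 9 / norm z ^ 5"
    using pos by (simp add: xy norm_Pair R_def)
  finally show ?thesis .
qed

lemma K_fun_differentiable:
  assumes \<beta>: "\<beta> > 0" and z: "z \<noteq> 0"
  shows "K_fun \<beta> differentiable (at z)" "partial1 (K_fun \<beta>) differentiable (at z)"
    "partial2 (K_fun \<beta>) differentiable (at z)"
proof -
  have f: "(\<lambda>z::real\<times>real. fst z) differentiable (at z)" "(\<lambda>z::real\<times>real. snd z) differentiable (at z)"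
    by (auto intro!: bounded_linear_imp_differentiable bounded_linear_fst bounded_linear_snd)
  have k: "(\<lambda>z. kernel_numerator \<beta> (fst z) (snd z)) differentiable (at z)"
    unfolding kernel_numerator_def using f by simp
  then show "K_fun \<beta> differentiable (at z)"
    unfolding K_fun_kernel_quotient[OF \<beta>] by (rule differentiable_kernel_quotient[OF \<beta> z])
  have "(\<lambda>z. numerator1 \<beta> (fst z) (snd z)) differentiable (at z)" "(\<lambda>z. numerator2 \<beta> (fst z) (snd z)) differentiable (at z)"
    unfolding numerator1_def numerator2_def using f k by simp_all
  then show "partial1 (K_fun \<beta>) differentiable (at z)" "partial2 (K_fun \<beta>) differentiable (at z)"
    by (auto intro: differentiable_transform_nonzero[OF partial1_K_fun[OF \<beta>] _ z]
        differentiable_transform_nonzero[OF partial2_K_fun[OF \<beta>] _ z] differentiable_kernel_quotient[OF \<beta> z])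
qed

section \<open>The symbol as an integral against the kernel\<close>

lemma borel_measurable_fst_snd [measurable]:
  "(fst :: real \<times> real \<Rightarrow> real) \<in> borel_measurable borel"
  "(snd :: real \<times> real \<Rightarrow> real) \<in> borel_measurable borel"
  by (simp_all add: borel_prod[symmetric])

text \<open>Change of variables \<open>(\<sigma>, t) \<mapsto> (t, t * \<sigma>)\<close> with
  Jacobian \<open>\<bar>t\<bar>\<close>. No multidimensional transformation theorem is involved: for
  each \<open>t \<noteq> 0\<close> the inner integral is rescaled linearly, and \<open>t = 0\<close>
  is a null set.\<close>

lemma lborel_eq_distr_slope:
  "(lborel :: (real \<times> real) measure) =
     distr (density lborel (\<lambda>p. ennreal \<bar>snd p\<bar>)) borel (\<lambda>p. (snd p, snd p * fst p))"
proof (rule measure_eqI)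
  fix A :: "(real \<times> real) set"
  assume "A \<in> sets lborel"
  then have A[measurable]: "A \<in> sets borel" by simp
  have [measurable]: "(\<lambda>p. (snd p, snd p * fst p)) \<in> borel_measurable (borel :: (real \<times> real) measure)"
    by (simp add: borel_prod[symmetric])
  have [measurable]: "A \<in> sets (borel \<Otimes>\<^sub>M borel)" using A unfolding borel_prod .
  have "emeasure lborel A = (\<integral>\<^sup>+p. indicator A p \<partial>(lborel \<Otimes>\<^sub>M lborel))"
    by (simp add: lborel_prod)
  also have "\<dots> = (\<integral>\<^sup>+t. (\<integral>\<^sup>+y. indicator A (t, y) \<partial>lborel) \<partial>lborel)"
    by (subst lborel.nn_integral_fst[symmetric]) (simp_all add: lborel_prod)
  also have "\<dots> = (\<integral>\<^sup>+t. (\<integral>\<^sup>+\<sigma>. ennreal \<bar>t\<bar> * indicator A (t, t * \<sigma>) \<partial>lborel) \<partial>lborel)"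
  proof (rule nn_integral_cong_AE)
    have "AE t in lborel. t \<noteq> (0::real)" by (rule AE_lborel_singleton)
    then show "AE t in lborel. (\<integral>\<^sup>+y. indicator A (t, y) \<partial>lborel) =
        (\<integral>\<^sup>+\<sigma>. ennreal \<bar>t\<bar> * indicator A (t, t * \<sigma>) \<partial>lborel)"
    proof eventually_elim
      case (elim t)
      show ?case
        by (subst nn_integral_real_affine[of _ t 0]) (simp_all add: elim nn_integral_cmult)
    qed
  qed
  also have "\<dots> = (\<integral>\<^sup>+p. ennreal \<bar>snd p\<bar> * indicator A (snd p, snd p * fst p) \<partial>(lborel \<Otimes>\<^sub>M lborel))"
    by (subst lborel_pair.nn_integral_snd[symmetric]) simp_all
  also have "\<dots> = (\<integral>\<^sup>+p. indicator A p \<partial>distr (density lborel (\<lambda>p. ennreal \<bar>snd p\<bar>)) borel (\<lambda>p. (snd p, snd p * fst p)))"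
    by (subst nn_integral_distr) (simp_all add: nn_integral_density lborel_prod)
  also have "\<dots> = emeasure (distr (density lborel (\<lambda>p. ennreal \<bar>snd p\<bar>)) borel (\<lambda>p. (snd p, snd p * fst p))) A"
    by simp
  finally show "emeasure lborel A = \<dots>" .
qed simp

lemma
  fixes f :: "real \<times> real \<Rightarrow> real"
  assumes [measurable]: "f \<in> borel_measurable borel"
  shows integrable_slope: "integrable lborel f \<longleftrightarrow>
      integrable (lborel \<Otimes>\<^sub>M lborel) (\<lambda>p. \<bar>snd p\<bar> * f (snd p, snd p * fst p))"
    and integral_slope: "integral\<^sup>L lborel f =
      integral\<^sup>L (lborel \<Otimes>\<^sub>M lborel) (\<lambda>p. \<bar>snd p\<bar> * f (snd p, snd p * fst p))"
proof -
  have [measurable]: "(\<lambda>p. (snd p, snd p * fst p)) \<in> borel_measurable (borel :: (real \<times> real) measure)"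
    by (simp add: borel_prod[symmetric])
  show "integrable lborel f \<longleftrightarrow>
      integrable (lborel \<Otimes>\<^sub>M lborel) (\<lambda>p. \<bar>snd p\<bar> * f (snd p, snd p * fst p))"
    by (subst lborel_eq_distr_slope) (simp add: integrable_distr_eq integrable_density lborel_prod)
  show "integral\<^sup>L lborel f =
      integral\<^sup>L (lborel \<Otimes>\<^sub>M lborel) (\<lambda>p. \<bar>snd p\<bar> * f (snd p, snd p * fst p))"
    by (subst lborel_eq_distr_slope) (simp add: integral_distr integral_density lborel_prod)
qed

text \<open>Integration by parts turns the integrand into \<open>sin t / t\<close>, which gives the
  primitive \<open>F\<close>; the value on the half-line is then the limit \<open>pi / 2\<close> of
  \<open>Si\<close>. As the integrand is nonnegative, the fundamental theorem yields integrability
  together with the value. Evenness and scaling do the rest.\<close>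

lemma has_bochner_integral_one_minus_cos:
  "has_bochner_integral lborel (\<lambda>t::real. (1 - cos (a * t)) / t\<^sup>2) (pi * \<bar>a\<bar>)"
proof -
  define F where "F = (\<lambda>t::real. Si t - (1 - cos t) / t)"
  define f where "f = (\<lambda>t::real. (1 - cos t) / t\<^sup>2)"
  have lim0: "(F \<longlongrightarrow> 0) (at_right 0)"
  proof -
    have "(Si \<longlongrightarrow> Si 0) (at_right 0)"
      using isCont_Si[of 0] by (simp add: isCont_def filterlim_at_split)
    moreover have "Si 0 = 0" by (simp add: Si_def zero_ereal_def)
    moreover have "((\<lambda>t::real. (1 - cos t) / t) \<longlongrightarrow> 0) (at_right 0)" by real_asymp
    ultimately show ?thesis unfolding F_def using tendsto_diff by fastforce
  qed
  have limi: "(F \<longlongrightarrow> pi / 2) at_top"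
  proof -
    have "((\<lambda>t::real. (1 - cos t) / t) \<longlongrightarrow> 0) at_top"
    proof (rule tendsto_sandwich[OF _ _ tendsto_const])
      show "\<forall>\<^sub>F t::real in at_top. 0 \<le> (1 - cos t) / t"
        using eventually_gt_at_top[of 0] by eventually_elim simp
      show "\<forall>\<^sub>F t::real in at_top. (1 - cos t) / t \<le> 2 / t"
        using eventually_gt_at_top[of 0]
      proof eventually_elim
        case (elim t)
        then show ?case using cos_ge_minus_one[of t] by (intro divide_right_mono) linarith+
      qed
      show "((\<lambda>t::real. 2 / t) \<longlongrightarrow> 0) at_top" by real_asymp
    qed
    from tendsto_diff[OF Si_at_top this] show ?thesis by (simp add: F_def)
  qed
  have F: "(F has_real_derivative f t) (at t)" if "t > 0" for t
    unfolding F_def f_def using that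
    by (auto intro!: derivative_eq_intros DERIV_Si simp: field_simps power2_eq_square)
  have cont: "isCont f t" if "t > 0" for t
    unfolding f_def using that by (auto intro!: continuous_intros)
  have int: "set_integrable lborel (einterval 0 \<infinity>) f" "(LBINT t=0..\<infinity>. f t) = pi / 2 - 0"
    by (rule interval_integral_FTC_nonneg[of 0 \<infinity> F f 0 "pi/2"];
        use F cont lim0 limi in \<open>auto simp: zero_ereal_def ereal_tendsto_simps f_def\<close>)+
  have "has_bochner_integral lborel (\<lambda>t. indicator {0..} t *\<^sub>R f t) (pi / 2)"
  proof -
    \<comment> \<open>Closed and open half-line agree exactly, not just almost everywhere, because
      division by 0 gives \<open>f 0 = 0\<close>.\<close>
    have e: "(\<lambda>t. indicator {0..} t *\<^sub>R f t) = (\<lambda>t. indicator (einterval 0 \<infinity>) t *\<^sub>R f t)"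
      by (auto simp: fun_eq_iff indicator_def einterval_def f_def zero_ereal_def)
    show ?thesis
      unfolding e using int
      by (simp add: has_bochner_integral_iff set_integrable_def interval_lebesgue_integral_def
          set_lebesgue_integral_def)
  qed
  then have 1: "has_bochner_integral lborel f pi"
    using has_bochner_integral_even_function[of f "pi/2"] by (simp add: f_def)
  show ?thesis
  proof (cases "a = 0")
    case False
    have "has_bochner_integral lborel (\<lambda>t. f (0 + a * t)) (pi /\<^sub>R \<bar>a\<bar>)"
      using 1 lborel_has_bochner_integral_real_affine_iff[OF False, of f pi 0] by simp
    then have "has_bochner_integral lborel (\<lambda>t. a\<^sup>2 * f (0 + a * t)) (a\<^sup>2 * (pi /\<^sub>R \<bar>a\<bar>))"
      by (rule has_bochner_integral_mult_right)
    moreover have "a\<^sup>2 * (pi /\<^sub>R \<bar>a\<bar>) = pi * \<bar>a\<bar>"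
      using False by (simp add: field_simps power2_eq_square abs_if)
    moreover have "(\<lambda>t. a\<^sup>2 * f (0 + a * t)) = (\<lambda>t. (1 - cos (a * t)) / t\<^sup>2)"
      using False by (auto simp: f_def fun_eq_iff power_mult_distrib)
    ultimately show ?thesis by (simp only:)
  qed (simp add: has_bochner_integral_zero)
qed

lemma integrable_inverse_1_plus_square_lborel: "integrable lborel (\<lambda>x::real. 1 / (1 + x\<^sup>2))"
  using integrable_inverse_1_plus_square by (simp add: set_integrable_def inverse_eq_divide)

text \<open>Stated for a general kernel of this homogeneity so that it applies to
  \<open>K_fun \<beta>\<close> and to its absolute value. By Cauchy-Schwarz the weight
  \<open>\<bar>fst k + \<sigma> * snd k\<bar>\<close> costs a factor
  \<open>sqrt (1 + \<sigma>\<^sup>2)\<close>, which is exactly the factor included in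
  \<open>bound\<close>.\<close>

lemma
  fixes K :: "real \<times> real \<Rightarrow> real" and \<kappa> :: "real \<Rightarrow> real"
  assumes [measurable]: "K \<in> borel_measurable borel" "\<kappa> \<in> borel_measurable borel"
    and hom: "\<And>t \<sigma>. t \<noteq> 0 \<Longrightarrow> K (t, t * \<sigma>) = \<kappa> \<sigma> / \<bar>t\<bar> ^ 3"
    and bound: "\<And>\<sigma>. \<bar>\<kappa> \<sigma>\<bar> * sqrt (1 + \<sigma>\<^sup>2) \<le> C / (1 + \<sigma>\<^sup>2)"
  shows integrable_slope_weight: "integrable lborel (\<lambda>\<sigma>. \<bar>fst k + \<sigma> * snd k\<bar> * \<kappa> \<sigma>)"
    and integrable_one_minus_cos: "integrable lborel (\<lambda>y. (1 - cos (k \<bullet> y)) * K y)"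
    and integral_one_minus_cos: "(LINT y|lborel. (1 - cos (k \<bullet> y)) * K y) =
      pi * (LINT \<sigma>|lborel. \<bar>fst k + \<sigma> * snd k\<bar> * \<kappa> \<sigma>)"
proof -
  have cs: "\<bar>fst k + \<sigma> * snd k\<bar> \<le> norm k * sqrt (1 + \<sigma>\<^sup>2)" for \<sigma>
    using Cauchy_Schwarz_ineq2[of k "(1, \<sigma>)"] by (simp add: inner_prod_def norm_Pair mult.commute)
  have le: "\<bar>fst k + \<sigma> * snd k\<bar> * \<bar>\<kappa> \<sigma>\<bar> \<le> norm k * (C / (1 + \<sigma>\<^sup>2))" for \<sigma>
  proof -
    have "\<bar>fst k + \<sigma> * snd k\<bar> * \<bar>\<kappa> \<sigma>\<bar> \<le> norm k * sqrt (1 + \<sigma>\<^sup>2) * \<bar>\<kappa> \<sigma>\<bar>"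
      by (intro mult_right_mono cs) simp
    also have "\<dots> = norm k * (\<bar>\<kappa> \<sigma>\<bar> * sqrt (1 + \<sigma>\<^sup>2))" by simp
    also have "\<dots> \<le> norm k * (C / (1 + \<sigma>\<^sup>2))"
      by (intro mult_left_mono bound) simp
    finally show ?thesis .
  qed
  have dom: "integrable lborel (\<lambda>\<sigma>. norm k * (C / (1 + \<sigma>\<^sup>2)))"
    using integrable_mult_right[OF integrable_inverse_1_plus_square_lborel, of "norm k * C"] by simp
  show w: "integrable lborel (\<lambda>\<sigma>. \<bar>fst k + \<sigma> * snd k\<bar> * \<kappa> \<sigma>)"
  proof (rule Bochner_Integration.integrable_bound[OF dom])
    have "norm (\<bar>fst k + \<sigma> * snd k\<bar> * \<kappa> \<sigma>) \<le> norm (norm k * (C / (1 + \<sigma>\<^sup>2)))" for \<sigma>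
      using order_trans[OF le abs_ge_self, of \<sigma>] by (simp only: real_norm_def abs_mult abs_abs)
    then show "AE \<sigma> in lborel. norm (\<bar>fst k + \<sigma> * snd k\<bar> * \<kappa> \<sigma>) \<le> norm (norm k * (C / (1 + \<sigma>\<^sup>2)))"
      by (intro AE_I2)
  qed simp
  define g where "g = (\<lambda>\<sigma> t. (1 - cos ((fst k + \<sigma> * snd k) * t)) / t\<^sup>2 * \<kappa> \<sigma>)"
  have g: "has_bochner_integral lborel (g \<sigma>) (pi * \<bar>fst k + \<sigma> * snd k\<bar> * \<kappa> \<sigma>)"
    "has_bochner_integral lborel (\<lambda>t. norm (g \<sigma> t)) (pi * \<bar>fst k + \<sigma> * snd k\<bar> * \<bar>\<kappa> \<sigma>\<bar>)" for \<sigma>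
    using has_bochner_integral_mult_left[OF has_bochner_integral_one_minus_cos, of "fst k + \<sigma> * snd k" "\<kappa> \<sigma>"]
      has_bochner_integral_mult_left[OF has_bochner_integral_one_minus_cos, of "fst k + \<sigma> * snd k" "\<bar>\<kappa> \<sigma>\<bar>"]
    by (simp_all add: g_def abs_mult)
  have [measurable]: "(\<lambda>y. (1 - cos (k \<bullet> y)) * K y) \<in> borel_measurable borel" by simp
  \<comment> \<open>The Jacobian \<open>\<bar>t\<bar>\<close> lowers
    \<open>\<bar>t\<bar> ^ 3\<close> to \<open>t\<^sup>2\<close>, and the two variables separate up
    to the frequency \<open>fst k + \<sigma> * snd k\<close>. At \<open>t = 0\<close> both sides are
    0.\<close>
  have eq: "(\<lambda>p. \<bar>snd p\<bar> * ((1 - cos (k \<bullet> (snd p, snd p * fst p))) * K (snd p, snd p * fst p))) = (\<lambda>(\<sigma>, t). g \<sigma> t)"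
  proof
    fix p :: "real \<times> real"
    obtain \<sigma> t where p: "p = (\<sigma>, t)" by fastforce
    show "\<bar>snd p\<bar> * ((1 - cos (k \<bullet> (snd p, snd p * fst p))) * K (snd p, snd p * fst p)) = (\<lambda>(\<sigma>, t). g \<sigma> t) p"
    proof (cases "t = 0")
      case False
      have "k \<bullet> (t, t * \<sigma>) = (fst k + \<sigma> * snd k) * t" by (simp add: inner_prod_def algebra_simps)
      moreover have "\<bar>t\<bar> * (\<kappa> \<sigma> / \<bar>t\<bar> ^ 3) = \<kappa> \<sigma> / t\<^sup>2"
        using False by (simp add: power3_eq_cube power2_eq_square abs_mult_self_eq)
      ultimately show ?thesis using hom[OF False, of \<sigma>]
        by (simp add: p g_def) (metis (no_types, opaque_lifting) mult.left_commute times_divide_eq_right)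
    qed (simp add: p g_def)
  qed
  have [measurable]: "(\<lambda>(\<sigma>, t). g \<sigma> t) \<in> borel_measurable (lborel \<Otimes>\<^sub>M lborel)"
    unfolding g_def by measurable
  \<comment> \<open>Because \<open>1 - cos\<close> is nonnegative, the inner integral of the norm is
    known exactly: it is \<open>pi\<close> times the absolute value of the integrable weight in
    \<open>w\<close>.\<close>
  have int: "integrable (lborel \<Otimes>\<^sub>M lborel) (\<lambda>(\<sigma>, t). g \<sigma> t)"
  proof (rule lborel_pair.Fubini_integrable)
    have "integrable lborel (\<lambda>\<sigma>. pi * norm (\<bar>fst k + \<sigma> * snd k\<bar> * \<kappa> \<sigma>))"
      by (intro integrable_mult_right integrable_norm w)
    then show "integrable lborel (\<lambda>\<sigma>. LINT t|lborel. norm ((\<lambda>(\<sigma>, t). g \<sigma> t) (\<sigma>, t)))"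
      using g(2) by (simp add: has_bochner_integral_iff abs_mult mult.assoc)
    show "AE \<sigma> in lborel. integrable lborel (\<lambda>t. (\<lambda>(\<sigma>, t). g \<sigma> t) (\<sigma>, t))"
      using g(1) by (simp add: has_bochner_integral_iff)
  qed simp
  show "integrable lborel (\<lambda>y. (1 - cos (k \<bullet> y)) * K y)"
    by (subst integrable_slope) (simp_all add: eq int)
  have "(LINT y|lborel. (1 - cos (k \<bullet> y)) * K y) = (LINT \<sigma>|lborel. (LINT t|lborel. g \<sigma> t))"
    by (subst integral_slope) (simp_all add: eq lborel_pair.integral_fst[OF int])
  also have "\<dots> = (LINT \<sigma>|lborel. pi * (\<bar>fst k + \<sigma> * snd k\<bar> * \<kappa> \<sigma>))"
    using g(1) by (simp add: has_bochner_integral_iff mult.assoc)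
  finally show "(LINT y|lborel. (1 - cos (k \<bullet> y)) * K y) =
      pi * (LINT \<sigma>|lborel. \<bar>fst k + \<sigma> * snd k\<bar> * \<kappa> \<sigma>)" by simp
qed

section \<open>The symbol on a line and integration by parts against its second derivative\<close>

text \<open>
  The factors \<open>sqrt _ ^ 1\<close> below are kept so that the three functions have the shape of
  the quotient rule \<open>DERIV_quotient_sqrt_quadratic\<close>.
\<close>

definition slope_symbol :: "real \<Rightarrow> real \<Rightarrow> real" where
  "slope_symbol \<beta> \<sigma> = (\<sigma>\<^sup>2 + 1)\<^sup>2 / (sqrt (\<sigma>\<^sup>2 + 1) ^ 1 * (\<beta> * \<sigma>\<^sup>2 + 1) ^ 1)"

definition slope_symbol' :: "real \<Rightarrow> real \<Rightarrow> real" where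
  "slope_symbol' \<beta> \<sigma> = \<sigma> * (3 * (\<beta> * \<sigma>\<^sup>2 + 1) - 2 * \<beta> * (\<sigma>\<^sup>2 + 1)) * (\<sigma>\<^sup>2 + 1)
     / (sqrt (\<sigma>\<^sup>2 + 1) ^ 1 * (\<beta> * \<sigma>\<^sup>2 + 1) ^ 2)"

definition slope_kernel :: "real \<Rightarrow> real \<Rightarrow> real" where
  "slope_kernel \<beta> \<sigma> = kernel_numerator \<beta> 1 \<sigma> / (sqrt (\<sigma>\<^sup>2 + 1) ^ 1 * (\<beta> * \<sigma>\<^sup>2 + 1) ^ 3)"

lemma quadratic_plus1_pos: "\<beta> > 0 \<Longrightarrow> \<beta> * \<sigma>\<^sup>2 + 1 > (0::real)"
  by (simp add: add_nonneg_pos)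

lemma sqrt_power3: "x > 0 \<Longrightarrow> sqrt x ^ 3 = x * sqrt x"
  by (simp add: power3_eq_cube)

lemma DERIV_slope_symbol:
  assumes "\<beta> > 0"
  shows "(slope_symbol \<beta> has_real_derivative slope_symbol' \<beta> \<sigma>) (at \<sigma>)"
proof -
  define R Q where "R = \<sigma>\<^sup>2 + 1" and "Q = \<beta> * \<sigma>\<^sup>2 + 1"
  have pos: "R > 0" "Q > 0" using quadratic_plus1_pos[OF assms] quadratic_plus1_pos[of 1 \<sigma>] by (simp_all add: R_def Q_def)
  have dA: "((\<lambda>\<sigma>. (\<sigma>\<^sup>2 + 1)\<^sup>2) has_real_derivative 4 * \<sigma> * R) (at \<sigma>)"
    unfolding R_def by (auto intro!: derivative_eq_intros simp: algebra_simps)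
  have e: "(4 * \<sigma> * R * R * Q - real 1 * R\<^sup>2 * \<sigma> * Q - 2 * real 1 * \<beta> * \<sigma> * R\<^sup>2 * R) / (sqrt R ^ (1 + 2) * Q ^ (1 + 1))
    = \<sigma> * (3 * Q - 2 * \<beta> * R) * R / (sqrt R ^ 1 * Q ^ 2)"
    using pos by (simp add: sqrt_power3 field_simps power2_eq_square)
  show ?thesis
    unfolding slope_symbol_def[abs_def] slope_symbol'_def
    using DERIV_quotient_sqrt_quadratic[OF dA, of 1 \<beta> 1 1 1] pos e unfolding R_def[symmetric] Q_def[symmetric]
    by (simp only:)
qed

lemma DERIV_slope_symbol':
  assumes "\<beta> > 0"
  shows "(slope_symbol' \<beta> has_real_derivative slope_kernel \<beta> \<sigma>) (at \<sigma>)"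
proof -
  define R Q where "R = \<sigma>\<^sup>2 + 1" and "Q = \<beta> * \<sigma>\<^sup>2 + 1"
  have pos: "R > 0" "Q > 0" using quadratic_plus1_pos[OF assms] quadratic_plus1_pos[of 1 \<sigma>] by (simp_all add: R_def Q_def)
  define B where "B = \<sigma> * (3 * Q - 2 * \<beta> * R) * R"
  define B' where "B' = (3 * Q - 2 * \<beta> * R) * R + \<sigma> * (2 * \<beta> * \<sigma>) * R + \<sigma> * (3 * Q - 2 * \<beta> * R) * (2 * \<sigma>)"
  have dA: "((\<lambda>\<sigma>. \<sigma> * (3 * (\<beta> * \<sigma>\<^sup>2 + 1) - 2 * \<beta> * (\<sigma>\<^sup>2 + 1)) * (\<sigma>\<^sup>2 + 1)) has_real_derivative B') (at \<sigma>)"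
    unfolding R_def Q_def B'_def by (auto intro!: derivative_eq_intros simp: algebra_simps power2_eq_square power3_eq_cube)
  have N: "B' * R * Q - real 1 * B * \<sigma> * Q - 2 * real 2 * \<beta> * \<sigma> * B * R = kernel_numerator \<beta> 1 \<sigma> * R"
  proof -
    have "kernel_numerator \<beta> 1 \<sigma> = (3*\<beta>\<^sup>2 - 2*\<beta>) * \<sigma> ^ 4 + (6 - 10*\<beta> + 6*\<beta>\<^sup>2) * \<sigma>\<^sup>2 + (3 - 2*\<beta>)"
      by (simp add: kernel_numerator_def)
    then show ?thesis
      unfolding B_def B'_def R_def Q_def of_nat_1 of_nat_numeral by algebra
  qed
  have e: "(B' * R * Q - real 1 * B * \<sigma> * Q - 2 * real 2 * \<beta> * \<sigma> * B * R) / (sqrt R ^ (1 + 2) * Q ^ (2 + 1))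
    = kernel_numerator \<beta> 1 \<sigma> / (sqrt R ^ 1 * Q ^ 3)"
    unfolding N using pos by (simp add: sqrt_power3)
  show ?thesis
    unfolding slope_symbol'_def[abs_def] slope_kernel_def
    using DERIV_quotient_sqrt_quadratic[OF dA, of 1 \<beta> 1 1 2] pos e
    unfolding R_def[symmetric] Q_def[symmetric] B_def[symmetric]
    by (simp only:)
qed

text \<open>The function is the primitive of \<open>(\<sigma> - a) * h'' \<sigma>\<close> given by
  integration by parts. Both of its terms grow linearly but their leading parts cancel, leaving
  finite limits. These are opposite at the two ends, which removes them from the final
  value.\<close>

lemma slope_symbol_asymptotics:
  assumes "\<beta> > 0"
  shows "((\<lambda>\<sigma>. (\<sigma> - a) * slope_symbol' \<beta> \<sigma> - slope_symbol \<beta> \<sigma>) \<longlongrightarrow> - a / \<beta>) at_top"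
    and "((\<lambda>\<sigma>. (\<sigma> - a) * slope_symbol' \<beta> \<sigma> - slope_symbol \<beta> \<sigma>) \<longlongrightarrow> a / \<beta>) at_bot"
proof -
  \<comment> \<open>After the cubic growth in the numerator has cancelled, only the first of the
    four quotients has a nonzero limit, \<open>1 / \<beta>\<^sup>2\<close> up to sign.\<close>
  have eq: "(\<sigma> - a) * slope_symbol' \<beta> \<sigma> - slope_symbol \<beta> \<sigma> =
      - a * \<beta> * (sqrt (\<sigma>\<^sup>2 + 1) * \<sigma> ^ 3 / (\<beta> * \<sigma>\<^sup>2 + 1)\<^sup>2) + (2 - 3 * \<beta>) * (sqrt (\<sigma>\<^sup>2 + 1) * \<sigma>\<^sup>2 / (\<beta> * \<sigma>\<^sup>2 + 1)\<^sup>2)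
      - a * (3 - 2 * \<beta>) * (sqrt (\<sigma>\<^sup>2 + 1) * \<sigma> / (\<beta> * \<sigma>\<^sup>2 + 1)\<^sup>2) - sqrt (\<sigma>\<^sup>2 + 1) / (\<beta> * \<sigma>\<^sup>2 + 1)\<^sup>2" for \<sigma>
  proof -
    define r Q where "r = sqrt (\<sigma>\<^sup>2 + 1)" and "Q = \<beta> * \<sigma>\<^sup>2 + 1"
    have r: "r > 0" "\<sigma>\<^sup>2 + 1 = r\<^sup>2"
      using quadratic_plus1_pos[of 1 \<sigma>] by (simp_all add: r_def)
    have Q: "Q > 0" using quadratic_plus1_pos[OF assms] by (simp add: Q_def)
    have "(\<sigma> - a) * slope_symbol' \<beta> \<sigma> - slope_symbol \<beta> \<sigma> =
        r * ((\<sigma> - a) * \<sigma> * (3 * Q - 2 * \<beta> * r\<^sup>2) - r\<^sup>2 * Q) / Q\<^sup>2"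
      unfolding slope_symbol_def slope_symbol'_def Q_def[symmetric] r_def[symmetric] r(2)
      using r(1) Q by (simp add: field_simps power2_eq_square)
    also have "(\<sigma> - a) * \<sigma> * (3 * Q - 2 * \<beta> * r\<^sup>2) - r\<^sup>2 * Q =
        - a * \<beta> * \<sigma> ^ 3 + (2 - 3 * \<beta>) * \<sigma>\<^sup>2 - a * (3 - 2 * \<beta>) * \<sigma> - 1"
      unfolding r(2)[symmetric] Q_def by algebra
    finally show ?thesis
      unfolding r_def[symmetric] Q_def[symmetric]
      by (simp add: diff_divide_distrib add_divide_distrib algebra_simps)
  qed
  show "((\<lambda>\<sigma>. (\<sigma> - a) * slope_symbol' \<beta> \<sigma> - slope_symbol \<beta> \<sigma>) \<longlongrightarrow> - a / \<beta>) at_top"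
  proof -
    have "((\<lambda>\<sigma>. sqrt (\<sigma>\<^sup>2 + 1) * \<sigma> ^ 3 / (\<beta> * \<sigma>\<^sup>2 + 1)\<^sup>2) \<longlongrightarrow> 1 / \<beta>\<^sup>2) at_top"
      "((\<lambda>\<sigma>. sqrt (\<sigma>\<^sup>2 + 1) * \<sigma>\<^sup>2 / (\<beta> * \<sigma>\<^sup>2 + 1)\<^sup>2) \<longlongrightarrow> 0) at_top"
      "((\<lambda>\<sigma>. sqrt (\<sigma>\<^sup>2 + 1) * \<sigma> / (\<beta> * \<sigma>\<^sup>2 + 1)\<^sup>2) \<longlongrightarrow> 0) at_top"
      "((\<lambda>\<sigma>. sqrt (\<sigma>\<^sup>2 + 1) / (\<beta> * \<sigma>\<^sup>2 + 1)\<^sup>2) \<longlongrightarrow> 0) at_top"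
      using assms by - (real_asymp simp: field_simps)+
    note lims = this
    show ?thesis
      unfolding eq using assms
      by (intro tendsto_eq_rhs[OF tendsto_diff[OF tendsto_diff[OF tendsto_add[OF tendsto_mult_left[OF lims(1)]
          tendsto_mult_left[OF lims(2)]] tendsto_mult_left[OF lims(3)]] lims(4)]]) (simp add: power2_eq_square)
  qed
  show "((\<lambda>\<sigma>. (\<sigma> - a) * slope_symbol' \<beta> \<sigma> - slope_symbol \<beta> \<sigma>) \<longlongrightarrow> a / \<beta>) at_bot"
  proof -
    have "((\<lambda>\<sigma>. sqrt (\<sigma>\<^sup>2 + 1) * \<sigma> ^ 3 / (\<beta> * \<sigma>\<^sup>2 + 1)\<^sup>2) \<longlongrightarrow> - 1 / \<beta>\<^sup>2) at_bot"
      "((\<lambda>\<sigma>. sqrt (\<sigma>\<^sup>2 + 1) * \<sigma>\<^sup>2 / (\<beta> * \<sigma>\<^sup>2 + 1)\<^sup>2) \<longlongrightarrow> 0) at_bot"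
      "((\<lambda>\<sigma>. sqrt (\<sigma>\<^sup>2 + 1) * \<sigma> / (\<beta> * \<sigma>\<^sup>2 + 1)\<^sup>2) \<longlongrightarrow> 0) at_bot"
      "((\<lambda>\<sigma>. sqrt (\<sigma>\<^sup>2 + 1) / (\<beta> * \<sigma>\<^sup>2 + 1)\<^sup>2) \<longlongrightarrow> 0) at_bot"
      using assms by - (real_asymp simp: field_simps)+
    note lims = this
    show ?thesis
      unfolding eq using assms
      by (intro tendsto_eq_rhs[OF tendsto_diff[OF tendsto_diff[OF tendsto_add[OF tendsto_mult_left[OF lims(1)]
          tendsto_mult_left[OF lims(2)]] tendsto_mult_left[OF lims(3)]] lims(4)]]) (simp add: power2_eq_square)
  qed
qed

lemma slope_kernel_bound:
  assumes "\<beta> > 0"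
  obtains C where "C \<ge> 0" "\<And>\<sigma>. \<bar>slope_kernel \<beta> \<sigma>\<bar> * sqrt (1 + \<sigma>\<^sup>2) \<le> C / (1 + \<sigma>\<^sup>2)"
proof
  \<comment> \<open>\<open>c\<close> is the ellipticity constant comparing the two quadratics,
    \<open>c * R \<le> Q\<close>; \<open>C'\<close> sums the absolute coefficients of the quartic,
    each of whose monomials is at most \<open>R\<^sup>2\<close>. Together they bound the quotient by
    \<open>C' * R\<^sup>2 / (c * R) ^ 3\<close>.\<close>
  define c where "c = min 1 \<beta>"
  define C' where "C' = \<bar>3*\<beta>\<^sup>2 - 2*\<beta>\<bar> + \<bar>6 - 10*\<beta> + 6*\<beta>\<^sup>2\<bar> + \<bar>3 - 2*\<beta>\<bar>"
  have c: "c > 0" "c \<le> 1" "c \<le> \<beta>" using assms by (auto simp: c_def)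
  have C': "C' \<ge> 0" by (simp add: C'_def)
  then show "C' / c ^ 3 \<ge> 0" using c by simp
  fix \<sigma> :: real
  define R Q where "R = \<sigma>\<^sup>2 + 1" and "Q = \<beta> * \<sigma>\<^sup>2 + 1"
  have R: "R \<ge> 1" by (simp add: R_def)
  have Q: "c * R \<le> Q" unfolding R_def Q_def using c by (simp add: distrib_left add_mono mult_right_mono)
  have R2: "1 \<le> R\<^sup>2" "\<sigma>\<^sup>2 \<le> R\<^sup>2" "\<sigma> ^ 4 \<le> R\<^sup>2"
  proof -
    have "R\<^sup>2 = \<sigma> ^ 4 + 2 * \<sigma>\<^sup>2 + 1" unfolding R_def by algebra
    moreover have "\<sigma>\<^sup>2 \<ge> 0" "\<sigma> ^ 4 \<ge> 0" by simp_all
    ultimately show "1 \<le> R\<^sup>2" "\<sigma>\<^sup>2 \<le> R\<^sup>2" "\<sigma> ^ 4 \<le> R\<^sup>2" by linarith+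
  qed
  have "\<bar>kernel_numerator \<beta> 1 \<sigma>\<bar> \<le> \<bar>3*\<beta>\<^sup>2 - 2*\<beta>\<bar> * \<sigma> ^ 4 + \<bar>6 - 10*\<beta> + 6*\<beta>\<^sup>2\<bar> * \<sigma>\<^sup>2 + \<bar>3 - 2*\<beta>\<bar> * 1"
    unfolding kernel_numerator_def
    by (rule order_trans[OF abs_triangle_ineq] add_mono)+ (simp_all add: abs_mult)
  also have "\<dots> \<le> \<bar>3*\<beta>\<^sup>2 - 2*\<beta>\<bar> * R\<^sup>2 + \<bar>6 - 10*\<beta> + 6*\<beta>\<^sup>2\<bar> * R\<^sup>2 + \<bar>3 - 2*\<beta>\<bar> * R\<^sup>2"
    by (intro add_mono mult_left_mono R2) simp_all
  finally have N: "\<bar>kernel_numerator \<beta> 1 \<sigma>\<bar> \<le> C' * R\<^sup>2" by (simp add: C'_def algebra_simps)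
  have Qpos: "Q > 0" using quadratic_plus1_pos[OF assms] by (simp add: Q_def)
  have "\<bar>slope_kernel \<beta> \<sigma>\<bar> * sqrt R = \<bar>kernel_numerator \<beta> 1 \<sigma>\<bar> / Q ^ 3"
    unfolding slope_kernel_def R_def[symmetric] Q_def[symmetric] using R Qpos by (simp add: abs_mult)
  also have "\<dots> \<le> C' * R\<^sup>2 / (c * R) ^ 3"
    using N Q R c C' by (intro frac_le power_mono) auto
  also have "\<dots> = C' / c ^ 3 / R"
    using R c by (simp add: field_simps power2_eq_square power3_eq_cube)
  finally show "\<bar>slope_kernel \<beta> \<sigma>\<bar> * sqrt (1 + \<sigma>\<^sup>2) \<le> C' / c ^ 3 / (1 + \<sigma>\<^sup>2)"
    by (simp add: R_def add.commute)
qed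

lemma isCont_slope_kernel:
  assumes "\<beta> > 0"
  shows "isCont (slope_kernel \<beta>) \<sigma>"
  unfolding slope_kernel_def kernel_numerator_def
  using quadratic_plus1_pos[OF assms, of \<sigma>] quadratic_plus1_pos[of 1 \<sigma>]
  by (intro continuous_intros) auto

lemma borel_measurable_slope_kernel [measurable]: "slope_kernel \<beta> \<in> borel_measurable borel"
  unfolding slope_kernel_def kernel_numerator_def by measurable

text \<open>The weak form of the fact that \<open>\<bar>\<sigma> - a\<bar>\<close> has second
  derivative \<open>2 * \<delta>_a\<close>. The line is split at \<open>a\<close>, where the
  primitive \<open>G\<close> equals \<open>- slope_symbol \<beta> a\<close>. Integrability is
  assumed because the integrand may change sign, so the fundamental theorem for nonnegative
  functions does not provide it.\<close>

lemma integral_abs_slope_kernel: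
  assumes \<beta>: "\<beta> > 0" and int: "integrable lborel (\<lambda>\<sigma>. \<bar>\<sigma> - a\<bar> * slope_kernel \<beta> \<sigma>)"
  shows "(LINT \<sigma>|lborel. \<bar>\<sigma> - a\<bar> * slope_kernel \<beta> \<sigma>) = 2 * slope_symbol \<beta> a"
proof -
  define G where "G = (\<lambda>\<sigma>. (\<sigma> - a) * slope_symbol' \<beta> \<sigma> - slope_symbol \<beta> \<sigma>)"
  define f where "f = (\<lambda>\<sigma>. \<bar>\<sigma> - a\<bar> * slope_kernel \<beta> \<sigma>)"
  have dG: "(G has_real_derivative (\<sigma> - a) * slope_kernel \<beta> \<sigma>) (at \<sigma>)" for \<sigma>
    unfolding G_def by (auto intro!: derivative_eq_intros DERIV_slope_symbol[OF \<beta>] DERIV_slope_symbol'[OF \<beta>])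
  have contG: "isCont G a" using dG DERIV_isCont by blast
  have Ga: "G a = - slope_symbol \<beta> a" by (simp add: G_def)
  have cont: "isCont f \<sigma>" for \<sigma>
    unfolding f_def by (intro continuous_intros isCont_slope_kernel[OF \<beta>])
  have fint: "set_integrable lborel A f" if "A \<in> sets borel" for A
    using integrable_mult_indicator[of A lborel f] int that by (simp add: set_integrable_def f_def)
  have "(LBINT \<sigma>=ereal a..\<infinity>. f \<sigma>) = - a / \<beta> - G a"
  proof (rule interval_integral_FTC_integrable[OF _ _ cont fint])
    show "(G has_vector_derivative f \<sigma>) (at \<sigma>)" if "ereal a < ereal \<sigma>" for \<sigma>
      using dG[of \<sigma>] that by (simp add: has_real_derivative_iff_has_vector_derivative f_def)
    show "((G \<circ> real_of_ereal) \<longlongrightarrow> G a) (at_right (ereal a))"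
      using contG by (simp add: ereal_tendsto_simps isCont_def filterlim_at_split)
    show "((G \<circ> real_of_ereal) \<longlongrightarrow> - a / \<beta>) (at_left \<infinity>)"
      using slope_symbol_asymptotics(1)[OF \<beta>, of a] by (simp add: ereal_tendsto_simps G_def)
  qed auto
  \<comment> \<open>To the left of \<open>a\<close> the absolute value flips the sign, so the
    primitive is \<open>- G\<close>. The limits \<open>- a / \<beta>\<close> and
    \<open>a / \<beta>\<close> from the two halves cancel in the sum.\<close>
  moreover have "(LBINT \<sigma>=-\<infinity>..ereal a. f \<sigma>) = - G a - - (a / \<beta>)"
  proof (rule interval_integral_FTC_integrable[OF _ _ cont fint])
    show "((\<lambda>\<sigma>. - G \<sigma>) has_vector_derivative f \<sigma>) (at \<sigma>)" if "ereal \<sigma> < ereal a" for \<sigma>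
      using DERIV_minus[OF dG[of \<sigma>]] that
      by (simp add: has_real_derivative_iff_has_vector_derivative f_def algebra_simps)
    show "(((\<lambda>\<sigma>. - G \<sigma>) \<circ> real_of_ereal) \<longlongrightarrow> - G a) (at_left (ereal a))"
      using contG by (simp add: ereal_tendsto_simps isCont_def filterlim_at_split tendsto_minus)
    show "(((\<lambda>\<sigma>. - G \<sigma>) \<circ> real_of_ereal) \<longlongrightarrow> - (a / \<beta>)) (at_right (-\<infinity>))"
      using tendsto_minus[OF slope_symbol_asymptotics(2)[OF \<beta>, of a]] by (simp add: ereal_tendsto_simps G_def)
  qed auto
  moreover have "(LBINT \<sigma>=-\<infinity>..ereal a. f \<sigma>) + (LBINT \<sigma>=ereal a..\<infinity>. f \<sigma>) = (LBINT \<sigma>=-\<infinity>..\<infinity>. f \<sigma>)"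
    by (rule interval_integral_sum) (auto simp: interval_lebesgue_integrable_def fint)
  moreover have "(LBINT \<sigma>=-\<infinity>..\<infinity>. f \<sigma>) = (LINT \<sigma>|lborel. f \<sigma>)"
    by (simp add: interval_lebesgue_integral_def set_lebesgue_integral_def)
  ultimately show ?thesis by (simp add: Ga f_def)
qed

lemma K_fun_slope:
  assumes \<beta>: "\<beta> > 0" and t: "t \<noteq> 0"
  shows "K_fun \<beta> (t, t * \<sigma>) = slope_kernel \<beta> \<sigma> / \<bar>t\<bar> ^ 3"
proof -
  have "sqrt (t\<^sup>2 + (t * \<sigma>)\<^sup>2) = \<bar>t\<bar> * sqrt (\<sigma>\<^sup>2 + 1)"
  proof -
    have "t\<^sup>2 + (t * \<sigma>)\<^sup>2 = t\<^sup>2 * (\<sigma>\<^sup>2 + 1)" by algebra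
    then show ?thesis by (simp add: real_sqrt_mult)
  qed
  moreover have "t\<^sup>2 + \<beta> * (t * \<sigma>)\<^sup>2 = t\<^sup>2 * (\<beta> * \<sigma>\<^sup>2 + 1)" by algebra
  moreover have "kernel_numerator \<beta> t (t * \<sigma>) = t ^ 4 * kernel_numerator \<beta> 1 \<sigma>"
    by (simp add: kernel_numerator_def algebra_simps power2_eq_square power4_eq_xxxx)
  ultimately have 1: "K_fun \<beta> (t, t * \<sigma>) = t ^ 4 * kernel_numerator \<beta> 1 \<sigma>
      / ((\<bar>t\<bar> * sqrt (\<sigma>\<^sup>2 + 1)) ^ 1 * (t\<^sup>2 * (\<beta> * \<sigma>\<^sup>2 + 1)) ^ 3)"
    by (simp only: K_fun_eq[OF \<beta>] fst_conv snd_conv)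
  have 2: "(\<bar>t\<bar> * r) ^ 1 * (t\<^sup>2 * q) ^ 3 = t ^ 4 * ((r ^ 1 * q ^ 3) * \<bar>t\<bar> ^ 3)" for q r
  proof -
    have "t\<^sup>2 = \<bar>t\<bar>\<^sup>2" "t ^ 4 = \<bar>t\<bar> ^ 4" by simp_all
    then show ?thesis by algebra
  qed
  show ?thesis
    unfolding 1 2 slope_kernel_def using t by simp
qed

text \<open>Measurability goes through the closed form; the definition itself rests on a definite
  description and on \<open>Arg\<close>.\<close>

lemma borel_measurable_K_fun [measurable]: "\<beta> > 0 \<Longrightarrow> K_fun \<beta> \<in> borel_measurable borel"
  by (subst measurable_cong[OF K_fun_eq]) (simp_all add: kernel_numerator_def)

text \<open>The third claim supplies the absolute convergence for Fubini: since
  \<open>K_fun \<beta>\<close> may change sign, its integral in the second claim does not control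
  \<open>\<bar>K_fun \<beta>\<bar>\<close>. Linear growth in \<open>k\<close> is affordable because
  it is absorbed by the decay of the Fourier transform.\<close>

lemma
  assumes \<beta>: "\<beta> > 0"
  shows integrable_K_fun: "integrable lborel (\<lambda>y. (1 - cos (k \<bullet> y)) * K_fun \<beta> y)"
    and integral_K_fun: "snd k \<noteq> 0 \<Longrightarrow>
      (LINT y|lborel. (1 - cos (k \<bullet> y)) * K_fun \<beta> y) = 2 * pi * L_symbol \<beta> k"
    and integral_abs_K_fun: "\<exists>C. \<forall>k. (LINT y|lborel. (1 - cos (k \<bullet> y)) * \<bar>K_fun \<beta> y\<bar>) \<le> C * norm k"
proof -
  obtain C where C: "C \<ge> 0" "\<And>\<sigma>. \<bar>slope_kernel \<beta> \<sigma>\<bar> * sqrt (1 + \<sigma>\<^sup>2) \<le> C / (1 + \<sigma>\<^sup>2)"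
    using slope_kernel_bound[OF \<beta>] by blast
  note [measurable] = borel_measurable_K_fun[OF \<beta>]
  note K = borel_measurable_K_fun[OF \<beta>] borel_measurable_slope_kernel K_fun_slope[OF \<beta>] C(2)
  show "integrable lborel (\<lambda>y. (1 - cos (k \<bullet> y)) * K_fun \<beta> y)"
    by (rule integrable_one_minus_cos[OF K]) 
  show "(LINT y|lborel. (1 - cos (k \<bullet> y)) * K_fun \<beta> y) = 2 * pi * L_symbol \<beta> k" if k: "snd k \<noteq> 0"
  proof -
    \<comment> \<open>The slope at which \<open>(1, \<sigma>)\<close> is orthogonal to
      \<open>k\<close>, that is, the kink of the weight. It exists only off the line
      \<open>snd k = 0\<close>, a null set in the later integration over \<open>k\<close>.\<close>
    define a where "a = - fst k / snd k"
    have e: "\<bar>fst k + \<sigma> * snd k\<bar> = \<bar>snd k\<bar> * \<bar>\<sigma> - a\<bar>" for \<sigma>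
      using k by (simp add: a_def abs_mult[symmetric] algebra_simps)
    have i: "integrable lborel (\<lambda>\<sigma>. \<bar>\<sigma> - a\<bar> * slope_kernel \<beta> \<sigma>)"
      using integrable_slope_weight[OF K, of k] k unfolding e mult.assoc by simp
    have "(LINT \<sigma>|lborel. \<bar>fst k + \<sigma> * snd k\<bar> * slope_kernel \<beta> \<sigma>) =
        (LINT \<sigma>|lborel. \<bar>snd k\<bar> * (\<bar>\<sigma> - a\<bar> * slope_kernel \<beta> \<sigma>))"
      by (simp only: e mult.assoc)
    also have "\<dots> = \<bar>snd k\<bar> * (2 * slope_symbol \<beta> a)"
      by (simp only: integral_mult_right_zero integral_abs_slope_kernel[OF \<beta> i])
    finally have "(LINT y|lborel. (1 - cos (k \<bullet> y)) * K_fun \<beta> y) = pi * (\<bar>snd k\<bar> * (2 * slope_symbol \<beta> a))"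
      using integral_one_minus_cos[OF K, of k] by simp
    \<comment> \<open>Homogeneity of degree 1 and evenness of the symbol, applied to
      \<open>k = snd k *\<^sub>R (- a, 1)\<close>.\<close>
    also have "\<bar>snd k\<bar> * slope_symbol \<beta> a = L_symbol \<beta> k"
    proof -
      define n where "n = norm k"
      have n: "n > 0" using k by (auto simp: n_def)
      have n2: "n\<^sup>2 = (fst k)\<^sup>2 + (snd k)\<^sup>2" by (simp add: n_def norm_prod_def)
      have a1: "a\<^sup>2 + 1 = n\<^sup>2 / (snd k)\<^sup>2"
        unfolding n2 a_def using k by (simp add: field_simps)
      have a2: "\<beta> * a\<^sup>2 + 1 = (\<beta> * (fst k)\<^sup>2 + (snd k)\<^sup>2) / (snd k)\<^sup>2"
        unfolding a_def using k by (simp add: field_simps)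
      have a3: "sqrt (a\<^sup>2 + 1) = n / \<bar>snd k\<bar>"
        unfolding a1 using n by (simp add: real_sqrt_divide)
      have q: "\<beta> * (fst k)\<^sup>2 + (snd k)\<^sup>2 > 0" using \<beta> k by (simp add: add_nonneg_pos)
      have s: "(snd k)\<^sup>2 = \<bar>snd k\<bar>\<^sup>2" "\<bar>snd k\<bar> > 0" using k by simp_all
      have "\<bar>snd k\<bar> * slope_symbol \<beta> a = n ^ 3 / (\<beta> * (fst k)\<^sup>2 + (snd k)\<^sup>2)"
      proof -
        have "b * ((n\<^sup>2 / b\<^sup>2)\<^sup>2 / ((n / b) ^ 1 * (q / b\<^sup>2) ^ 1)) = n ^ 3 / q" if "b > 0" "q > 0" for b q
          using n that by (simp add: field_simps power2_eq_square power3_eq_cube)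
        from this[OF s(2) q] show ?thesis
          unfolding slope_symbol_def a3 a2 unfolding a1 s(1)[symmetric] .
      qed
      then show ?thesis by (simp add: L_symbol_def n_def)
    qed
    ultimately show ?thesis by (simp add: algebra_simps)
  qed
  have K': "(\<lambda>y. \<bar>K_fun \<beta> y\<bar>) \<in> borel_measurable borel" "(\<lambda>\<sigma>. \<bar>slope_kernel \<beta> \<sigma>\<bar>) \<in> borel_measurable borel"
    "\<And>t \<sigma>. t \<noteq> 0 \<Longrightarrow> \<bar>K_fun \<beta> (t, t * \<sigma>)\<bar> = \<bar>slope_kernel \<beta> \<sigma>\<bar> / \<bar>t\<bar> ^ 3"
    "\<And>\<sigma>. \<bar>\<bar>slope_kernel \<beta> \<sigma>\<bar>\<bar> * sqrt (1 + \<sigma>\<^sup>2) \<le> C / (1 + \<sigma>\<^sup>2)"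
    using C(2) by (auto simp: K_fun_slope[OF \<beta>])
  show "\<exists>C. \<forall>k. (LINT y|lborel. (1 - cos (k \<bullet> y)) * \<bar>K_fun \<beta> y\<bar>) \<le> C * norm k"
  proof (intro exI allI)
    fix k :: "real \<times> real"
    have "(LINT y|lborel. (1 - cos (k \<bullet> y)) * \<bar>K_fun \<beta> y\<bar>) =
        pi * (LINT \<sigma>|lborel. \<bar>fst k + \<sigma> * snd k\<bar> * \<bar>slope_kernel \<beta> \<sigma>\<bar>)"
      by (rule integral_one_minus_cos[OF K'])
    also have "\<dots> \<le> pi * (LINT \<sigma>|lborel. norm k * C * (1 / (1 + \<sigma>\<^sup>2)))"
    proof (intro mult_left_mono integral_mono)
      fix \<sigma>
      have "\<bar>fst k + \<sigma> * snd k\<bar> * \<bar>slope_kernel \<beta> \<sigma>\<bar> \<le> norm k * sqrt (1 + \<sigma>\<^sup>2) * \<bar>slope_kernel \<beta> \<sigma>\<bar>"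
        using Cauchy_Schwarz_ineq2[of k "(1, \<sigma>)"]
        by (intro mult_right_mono) (simp_all add: inner_prod_def norm_Pair mult.commute)
      also have "\<dots> = norm k * (\<bar>slope_kernel \<beta> \<sigma>\<bar> * sqrt (1 + \<sigma>\<^sup>2))" by simp
      also have "\<dots> \<le> norm k * (C / (1 + \<sigma>\<^sup>2))"
        by (intro mult_left_mono C) simp
      finally show "\<bar>fst k + \<sigma> * snd k\<bar> * \<bar>slope_kernel \<beta> \<sigma>\<bar> \<le> norm k * C * (1 / (1 + \<sigma>\<^sup>2))" by simp
    next
      show "integrable lborel (\<lambda>\<sigma>. norm k * C * (1 / (1 + \<sigma>\<^sup>2)))"
        by (intro integrable_mult_right integrable_inverse_1_plus_square_lborel)
    qed (use pi_ge_zero integrable_slope_weight[OF K'] in simp_all)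
    also have "\<dots> = (pi * C * (LINT \<sigma>|lborel. 1 / (1 + \<sigma>\<^sup>2 :: real))) * norm k" by (simp only: integral_mult_right_zero mult_ac)
    finally show "(LINT y|lborel. (1 - cos (k \<bullet> y)) * \<bar>K_fun \<beta> y\<bar>) \<le>
      (pi * C * (LINT \<sigma>|lborel. 1 / (1 + \<sigma>\<^sup>2 :: real))) * norm k" .
  qed
qed

section \<open>Fourier inversion\<close>

lemma
  fixes f :: "'a::euclidean_space \<Rightarrow> 'c::{real_normed_field, banach, second_countable_topology}"
    and g :: "'b::euclidean_space \<Rightarrow> 'c"
  assumes f: "integrable lborel f" and g: "integrable lborel g"
  shows integrable_lborel_mult: "integrable (lborel \<Otimes>\<^sub>M lborel) (\<lambda>(x, y). f x * g y)"
    and integral_lborel_mult: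
      "(LINT p|(lborel \<Otimes>\<^sub>M lborel). (case p of (x, y) \<Rightarrow> f x * g y)) = integral\<^sup>L lborel f * integral\<^sup>L lborel g"
proof -
  have [measurable]: "f \<in> borel_measurable borel" "g \<in> borel_measurable borel"
    using f g by auto
  show int: "integrable (lborel \<Otimes>\<^sub>M lborel) (\<lambda>(x, y). f x * g y)"
  proof (rule lborel_pair.Fubini_integrable)
    show "integrable lborel (\<lambda>x. LINT y|lborel. norm ((\<lambda>(x, y). f x * g y) (x, y)))"
      using f by (simp add: norm_mult)
    show "AE x in lborel. integrable lborel (\<lambda>y. (\<lambda>(x, y). f x * g y) (x, y))"
      using g by simp
  qed simp
  show "(LINT p|(lborel \<Otimes>\<^sub>M lborel). (case p of (x, y) \<Rightarrow> f x * g y)) = integral\<^sup>L lborel f * integral\<^sup>L lborel g"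
    using lborel_pair.integral_fst'[OF int] by simp
qed

lemma integrable_product_decay:
  "integrable lborel (\<lambda>x::real \<times> real. C / ((1 + (fst x)\<^sup>2) * (1 + (snd x)\<^sup>2)))"
  using integrable_mult_right[OF integrable_lborel_mult[OF integrable_inverse_1_plus_square_lborel integrable_inverse_1_plus_square_lborel], of C]
  by (simp add: lborel_prod case_prod_beta)

lemma integral_lborel_affine:
  fixes f :: "real \<times> real \<Rightarrow> complex"
  assumes [measurable]: "f \<in> borel_measurable borel" and c: "c \<noteq> 0"
  shows "(LINT x|lborel. f x) = of_real (c\<^sup>2) * (LINT x|lborel. f (t + c *\<^sub>R x))"
  by (subst lborel_affine[OF c, of t]) (simp add: integral_density integral_distr scaleR_conv_of_real power2_eq_square)

section \<open>The Gaussian and its transform\<close>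

text \<open>Unit variance and no normalizing factor: with this choice the Fourier transform is
  \<open>2 * pi\<close> times the function itself, so one function serves as damping factor and as
  approximate identity.\<close>

definition gaussian :: "real \<times> real \<Rightarrow> real" where
  "gaussian z = exp (- (norm z)\<^sup>2 / 2)"

lemma borel_measurable_gaussian [measurable]: "gaussian \<in> borel_measurable borel"
  unfolding gaussian_def by measurable

lemma fourier_std_normal_density:
  "integrable lborel (\<lambda>t. of_real (std_normal_density t) * iexp (z * t))"
  "(LINT t|lborel. of_real (std_normal_density t) * iexp (z * t)) = of_real (exp (- z\<^sup>2 / 2))"
proof -
  show "integrable lborel (\<lambda>t. of_real (std_normal_density t) * iexp (z * t))"
    by (rule Bochner_Integration.integrable_bound[of lborel std_normal_density])
       (auto simp: norm_mult intro: integrable_std_normal_moment[of 0, simplified])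
  have "char std_normal_distribution z = (LINT t|lborel. std_normal_density t *\<^sub>R iexp (z * t))"
    unfolding char_def by (subst integral_density) (auto simp: normal_density_nonneg)
  then show "(LINT t|lborel. of_real (std_normal_density t) * iexp (z * t)) = of_real (exp (- z\<^sup>2 / 2))"
    by (simp add: char_std_normal_distribution scaleR_conv_of_real)
qed

lemma
  shows integrable_gaussian_iexp: "integrable lborel (\<lambda>k. of_real (gaussian k) * iexp (k \<bullet> z))"
    and integral_gaussian_iexp: "(LINT k|lborel. of_real (gaussian k) * iexp (k \<bullet> z)) = 2 * pi * gaussian z"
proof -
  have e: "of_real (gaussian k) * iexp (k \<bullet> z) = 2 * pi *
      (case k of (k1, k2) \<Rightarrow> (of_real (std_normal_density k1) * iexp (fst z * k1)) * (of_real (std_normal_density k2) * iexp (snd z * k2)))" for k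
  proof -
    obtain a b where k: "k = (a, b)" by fastforce
    have "exp (- (a\<^sup>2 + b\<^sup>2) / 2) = exp (- a\<^sup>2 / 2) * exp (- b\<^sup>2 / 2)"
      by (simp add: exp_add[symmetric] add_divide_distrib)
    moreover have "sqrt (2 * pi) * sqrt (2 * pi) = 2 * pi" by simp
    ultimately have "gaussian k = 2 * pi * (std_normal_density a * std_normal_density b)"
      unfolding gaussian_def k std_normal_density_def norm_Pair by (simp add: field_simps)
    moreover have "iexp (k \<bullet> z) = iexp (fst z * a) * iexp (snd z * b)"
      unfolding k by (simp add: inner_prod_def exp_add[symmetric] algebra_simps)
    ultimately show ?thesis by (simp add: k)
  qed
  note i = integrable_lborel_mult[OF fourier_std_normal_density(1)[of "fst z"] fourier_std_normal_density(1)[of "snd z"]]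
  note I = integral_lborel_mult[OF fourier_std_normal_density(1)[of "fst z"] fourier_std_normal_density(1)[of "snd z"]]
  show "integrable lborel (\<lambda>k. of_real (gaussian k) * iexp (k \<bullet> z))"
    unfolding e using i by (intro integrable_mult_right) (simp add: lborel_prod)
  have "exp (- (fst z)\<^sup>2 / 2) * exp (- (snd z)\<^sup>2 / 2) = gaussian z"
    by (simp add: gaussian_def norm_prod_def exp_add[symmetric] add_divide_distrib)
  then have "(of_real (exp (- (fst z)\<^sup>2 / 2)) * of_real (exp (- (snd z)\<^sup>2 / 2)) :: complex) = of_real (gaussian z)"
    by (simp only: of_real_mult[symmetric])
  then show "(LINT k|lborel. of_real (gaussian k) * iexp (k \<bullet> z)) = 2 * pi * gaussian z"
    unfolding e using I[unfolded lborel_prod fourier_std_normal_density(2)] by simp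
qed

lemma integrable_gaussian: "integrable lborel gaussian"
  using integrable_norm[OF integrable_gaussian_iexp[of 0]] by (simp add: gaussian_def[abs_def])

lemma integral_gaussian: "integral\<^sup>L lborel gaussian = 2 * pi"
proof -
  have "complex_of_real (integral\<^sup>L lborel gaussian) = of_real (2 * pi)"
    using integral_gaussian_iexp[of 0] by (simp add: gaussian_def flip: integral_complex_of_real)
  then show ?thesis by (simp only: of_real_eq_iff)
qed

lemma integrable_gaussian_scaled:
  assumes "c > 0"
  shows "integrable lborel (\<lambda>k. gaussian (c *\<^sub>R k))"
proof -
  have "integrable (density (distr lborel borel (\<lambda>x. 0 + c *\<^sub>R x)) (\<lambda>_. \<bar>c\<bar> ^ DIM(real \<times> real))) gaussian"
    using integrable_gaussian assms by (subst (asm) lborel_affine[of c 0]) auto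
  then show ?thesis
    using assms by (simp add: integrable_density integrable_distr_eq)
qed

text \<open>Gaussian summation: \<open>A n\<close> is the inversion integral damped by
  \<open>gaussian (\<epsilon> n *\<^sub>R k)\<close>. On the frequency side it tends to the undamped
  integral, dominated by \<open>fourier u\<close>; rewritten on the space side it averages
  \<open>u\<close> over Gaussians concentrating at \<open>x\<close>.\<close>

lemma fourier_inversion:
  assumes u: "continuous_on UNIV u" and B: "\<And>x. norm (u x) \<le> B"
    and ui: "integrable lborel u" and fi: "integrable lborel (fourier u)"
  shows "(LINT k|lborel. fourier u k * exp (\<i> * of_real (k \<bullet> x))) = of_real ((2 * pi)\<^sup>2) * u x"
proof -
  define \<epsilon> where "\<epsilon> = (\<lambda>n. 1 / real (Suc n))"
  have \<epsilon>: "\<epsilon> n > 0" for n by (simp add: \<epsilon>_def)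
  have \<epsilon>0: "\<epsilon> \<longlonglongrightarrow> 0" unfolding \<epsilon>_def by (rule LIMSEQ_Suc[OF lim_1_over_n])
  have [measurable]: "u \<in> borel_measurable borel"
    using u by (rule borel_measurable_continuous_onI)
  have [measurable]: "fourier u \<in> borel_measurable borel" using fi by auto
  have G1: "gaussian z \<le> 1" "gaussian z \<ge> 0" for z by (simp_all add: gaussian_def)
  have contG: "(\<lambda>n. gaussian (\<epsilon> n *\<^sub>R k)) \<longlonglongrightarrow> 1" for k
  proof -
    have "(\<lambda>n. exp (- (norm (\<epsilon> n *\<^sub>R k))\<^sup>2 / 2)) \<longlonglongrightarrow> exp (- (norm (0 *\<^sub>R k))\<^sup>2 / 2)"
      by (intro tendsto_intros \<epsilon>0) simp
    then show ?thesis by (simp add: gaussian_def)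
  qed
  define A where "A = (\<lambda>n. LINT k|lborel. fourier u k * iexp (k \<bullet> x) * of_real (gaussian (\<epsilon> n *\<^sub>R k)))"
  have lim1: "A \<longlonglongrightarrow> (LINT k|lborel. fourier u k * iexp (k \<bullet> x))"
    unfolding A_def
  proof (rule integral_dominated_convergence[where w="\<lambda>k. norm (fourier u k)"])
    show "AE k in lborel. (\<lambda>n. fourier u k * iexp (k \<bullet> x) * of_real (gaussian (\<epsilon> n *\<^sub>R k))) \<longlonglongrightarrow> fourier u k * iexp (k \<bullet> x)"
      using tendsto_mult_left[OF tendsto_of_real[OF contG]] by (intro AE_I2) fastforce
    show "AE k in lborel. norm (fourier u k * iexp (k \<bullet> x) * of_real (gaussian (\<epsilon> n *\<^sub>R k))) \<le> norm (fourier u k)" for n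
      using G1 by (intro AE_I2) (simp add: norm_mult mult_left_le)
  qed (use fi in simp_all)
  have eq: "A n = (LINT z|lborel. u (x + \<epsilon> n *\<^sub>R z) * of_real (2 * pi * gaussian z))" for n
  proof -
    define e where "e = \<epsilon> n"
    have e: "e > 0" using \<epsilon> by (simp add: e_def)
    \<comment> \<open>The damping factor supplies integrability in \<open>k\<close>:
      \<open>norm (\<Phi> k y)\<close> is the product of \<open>gaussian (e *\<^sub>R k)\<close> and
      \<open>norm (u y)\<close>. Without it the exchange of integrals would fail absolute
      convergence.\<close>
    define \<Phi> where "\<Phi> = (\<lambda>k y. u y * (iexp (k \<bullet> (x - y)) * of_real (gaussian (e *\<^sub>R k))))"
    have [measurable]: "(\<lambda>(k, y). \<Phi> k y) \<in> borel_measurable (lborel \<Otimes>\<^sub>M lborel)"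
      unfolding \<Phi>_def by measurable
    have int: "integrable (lborel \<Otimes>\<^sub>M lborel) (\<lambda>(k, y). \<Phi> k y)"
      by (rule Bochner_Integration.integrable_bound[OF integrable_lborel_mult[OF integrable_gaussian_scaled[OF e] integrable_norm[OF ui]]])
         (auto simp: \<Phi>_def norm_mult G1 mult.commute)
    have "A n = (LINT k|lborel. LINT y|lborel. \<Phi> k y)"
      unfolding A_def fourier_def
    proof (rule Bochner_Integration.integral_cong[OF refl])
      fix k :: "real \<times> real"
      have "(LINT y|lborel. \<Phi> k y) = (LINT y|lborel. u y * exp (- \<i> * of_real (k \<bullet> y)) * (iexp (k \<bullet> x) * of_real (gaussian (e *\<^sub>R k))))"
        by (intro Bochner_Integration.integral_cong refl)
           (simp add: \<Phi>_def inner_diff_right right_diff_distrib exp_diff exp_minus field_simps)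
      then show "(LINT y|lborel. u y * exp (- \<i> * of_real (k \<bullet> y))) * iexp (k \<bullet> x) * of_real (gaussian (\<epsilon> n *\<^sub>R k))
         = (LINT y|lborel. \<Phi> k y)"
        by (simp add: e_def)
    qed
    also have "\<dots> = (LINT y|lborel. LINT k|lborel. \<Phi> k y)"
      using lborel_pair.Fubini_integral[OF int] by simp
    \<comment> \<open>Rescaling \<open>k\<close> by \<open>1 / e\<close> reduces the inner integral
      to the transform of the Gaussian. The next substitution \<open>y = x + e *\<^sub>R z\<close>
      produces \<open>e\<^sup>2\<close>, which cancels the factor
      \<open>1 / e\<^sup>2\<close>.\<close>
    also have "\<dots> = (LINT y|lborel. u y * (of_real (1 / e\<^sup>2) * of_real (2 * pi * gaussian ((1 / e) *\<^sub>R (x - y)))))"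
    proof (rule Bochner_Integration.integral_cong[OF refl])
      fix y :: "real \<times> real"
      have "(LINT k|lborel. iexp (k \<bullet> (x - y)) * of_real (gaussian (e *\<^sub>R k))) =
          of_real ((1 / e)\<^sup>2) * (LINT k|lborel. iexp ((0 + (1 / e) *\<^sub>R k) \<bullet> (x - y)) * of_real (gaussian (e *\<^sub>R (0 + (1 / e) *\<^sub>R k))))"
        using e by (intro integral_lborel_affine) simp_all
      also have "\<dots> = of_real (1 / e\<^sup>2) * (LINT k|lborel. of_real (gaussian k) * iexp (k \<bullet> ((1 / e) *\<^sub>R (x - y))))"
        using e by (simp add: power_one_over mult.commute)
      finally have "(LINT k|lborel. iexp (k \<bullet> (x - y)) * of_real (gaussian (e *\<^sub>R k))) =
          of_real (1 / e\<^sup>2) * of_real (2 * pi * gaussian ((1 / e) *\<^sub>R (x - y)))"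
        unfolding integral_gaussian_iexp by simp
      then show "(LINT k|lborel. \<Phi> k y) = u y * (of_real (1 / e\<^sup>2) * of_real (2 * pi * gaussian ((1 / e) *\<^sub>R (x - y))))"
        by (simp add: \<Phi>_def)
    qed
    also have "\<dots> = of_real (e\<^sup>2) * (LINT z|lborel. u (x + e *\<^sub>R z) * (of_real (1 / e\<^sup>2) * of_real (2 * pi * gaussian ((1 / e) *\<^sub>R (x - (x + e *\<^sub>R z))))))"
      using e by (intro integral_lborel_affine) simp_all
    also have "\<dots> = of_real (e\<^sup>2) * (LINT z|lborel. of_real (1 / e\<^sup>2) * (u (x + e *\<^sub>R z) * of_real (2 * pi * gaussian z)))"
      using e by (simp add: gaussian_def mult_ac)
    also have "\<dots> = (LINT z|lborel. u (x + e *\<^sub>R z) * of_real (2 * pi * gaussian z))"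
      using e by simp
    finally show ?thesis by (simp add: e_def)
  qed
  have lim2: "A \<longlonglongrightarrow> (LINT z|lborel. u x * of_real (2 * pi * gaussian z))"
    unfolding eq
  proof (rule integral_dominated_convergence[where w="\<lambda>z. B * (2 * pi * gaussian z)"])
    have "(\<lambda>n. u (x + \<epsilon> n *\<^sub>R z)) \<longlonglongrightarrow> u (x + 0 *\<^sub>R z)" for z
    proof (rule continuous_on_tendsto_compose[OF u])
      show "(\<lambda>n. x + \<epsilon> n *\<^sub>R z) \<longlonglongrightarrow> x + 0 *\<^sub>R z"
        by (intro tendsto_intros \<epsilon>0)
    qed simp_all
    then show "AE z in lborel. (\<lambda>n. u (x + \<epsilon> n *\<^sub>R z) * of_real (2 * pi * gaussian z)) \<longlonglongrightarrow> u x * of_real (2 * pi * gaussian z)"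
      by (intro AE_I2 tendsto_mult_right) simp
    show "AE z in lborel. norm (u (x + \<epsilon> n *\<^sub>R z) * of_real (2 * pi * gaussian z)) \<le> B * (2 * pi * gaussian z)" for n
      using B G1 by (intro AE_I2) (simp add: norm_mult mult_right_mono)
  qed (use integrable_gaussian in simp_all)
  have "(LINT k|lborel. fourier u k * iexp (k \<bullet> x)) = (LINT z|lborel. u x * of_real (2 * pi * gaussian z))"
    by (rule LIMSEQ_unique[OF lim1 lim2])
  \<comment> \<open>The constant \<open>(2 * pi)\<^sup>2\<close> arises as \<open>2 * pi\<close>
    from the transform of the Gaussian times \<open>2 * pi\<close> from its total mass.\<close>
  also have "\<dots> = u x * of_real (LINT z|lborel. 2 * pi * gaussian z)"
    by (simp only: integral_mult_right_zero integral_complex_of_real)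
  also have "\<dots> = of_real ((2 * pi)\<^sup>2) * u x"
    by (simp add: integral_gaussian power2_eq_square)
  finally show ?thesis .
qed

section \<open>Fourier transforms of Schwartz functions\<close>

text \<open>Isolates what integration by parts in one coordinate needs from a Schwartz function and
  its derivatives. The product form of the bound makes it integrable on the plane and, with the
  other coordinate fixed, forces decay along every coordinate line.\<close>

definition decaying :: "(real \<times> real \<Rightarrow> complex) \<Rightarrow> bool" where
  "decaying w \<longleftrightarrow> (\<forall>x. w differentiable (at x)) \<and>
     (\<exists>C. \<forall>x. norm (w x) \<le> C / ((1 + (fst x)\<^sup>2) * (1 + (snd x)\<^sup>2)))"

lemma decaying_schwartz:
  assumes "schwartz u"
  shows "decaying ((partial1 ^^ a) ((partial2 ^^ b) u))"
proof -
  let ?w = "(partial1 ^^ a) ((partial2 ^^ b) u)"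
  have "\<forall>m n. \<exists>C. \<forall>x. norm (of_real (fst x ^ m * snd x ^ n) * ?w x) \<le> C"
    using assms by (auto simp: schwartz_def)
  then obtain C where C: "\<And>m n x. norm (of_real (fst x ^ m * snd x ^ n) * ?w x) \<le> C m n"
    by metis
  \<comment> \<open>The four constants belong to the four monomials of
    \<open>(1 + (fst x)\<^sup>2) * (1 + (snd x)\<^sup>2)\<close>.\<close>
  have "norm (?w x) \<le> (C 0 0 + C 2 0 + C 0 2 + C 2 2) / ((1 + (fst x)\<^sup>2) * (1 + (snd x)\<^sup>2))" for x
  proof -
    have "norm (?w x) * ((1 + (fst x)\<^sup>2) * (1 + (snd x)\<^sup>2)) =
        norm (of_real (fst x ^ 0 * snd x ^ 0) * ?w x) + norm (of_real (fst x ^ 2 * snd x ^ 0) * ?w x)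
      + norm (of_real (fst x ^ 0 * snd x ^ 2) * ?w x) + norm (of_real (fst x ^ 2 * snd x ^ 2) * ?w x)"
      by (simp add: norm_mult algebra_simps flip: of_real_power)
    also have "\<dots> \<le> C 0 0 + C 2 0 + C 0 2 + C 2 2"
      by (intro add_mono C)
    finally show ?thesis
      by (subst pos_le_divide_eq) (auto intro!: mult_pos_pos add_pos_nonneg)
  qed
  then show ?thesis
    using assms unfolding decaying_def schwartz_def by blast
qed

lemma decaying_continuous: "decaying w \<Longrightarrow> continuous_on UNIV w"
  unfolding decaying_def by (simp add: continuous_on_eq_continuous_at differentiable_imp_continuous_within)

lemma integrable_of_decay:
  fixes f :: "real \<times> real \<Rightarrow> 'a::{banach, second_countable_topology}"
  assumes "f \<in> borel_measurable borel" "\<And>x. norm (f x) \<le> C / ((1 + (fst x)\<^sup>2) * (1 + (snd x)\<^sup>2))"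
  shows "integrable lborel f"
proof (rule Bochner_Integration.integrable_bound[OF integrable_product_decay[of C]])
  have "norm (f x) \<le> norm (C / ((1 + (fst x)\<^sup>2) * (1 + (snd x)\<^sup>2)))" for x
    unfolding real_norm_def by (rule order_trans[OF assms(2) abs_ge_self])
  then show "AE x in lborel. norm (f x) \<le> norm (C / ((1 + (fst x)\<^sup>2) * (1 + (snd x)\<^sup>2)))"
    by (intro AE_I2)
qed (use assms(1) in simp)

lemma decaying_integrable:
  assumes "decaying w"
  shows "integrable lborel w"
proof -
  obtain C where C: "\<And>x. norm (w x) \<le> C / ((1 + (fst x)\<^sup>2) * (1 + (snd x)\<^sup>2))"
    using assms unfolding decaying_def by blast
  show ?thesis
    by (rule integrable_of_decay[OF borel_measurable_continuous_onI[OF decaying_continuous[OF assms]] C])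
qed

lemma decaying_partials:
  assumes "decaying w"
  shows "((\<lambda>t. w (t, y)) has_vector_derivative partial1 w (t, y)) (at t)"
    and "((\<lambda>t. w (x, t)) has_vector_derivative partial2 w (x, t)) (at t)"
proof -
  have "w differentiable (at (t, y))" using assms by (simp add: decaying_def)
  moreover have "(\<lambda>t. (t, y)) differentiable (at t)"
    by (intro differentiable_Pair) simp_all
  ultimately have "(w \<circ> (\<lambda>t. (t, y))) differentiable (at t)"
    by (intro differentiable_chain_at) simp_all
  then show "((\<lambda>t. w (t, y)) has_vector_derivative partial1 w (t, y)) (at t)"
    by (simp add: partial1_def o_def vector_derivative_works)
  have "w differentiable (at (x, t))" using assms by (simp add: decaying_def)
  moreover have "(\<lambda>t. (x, t)) differentiable (at t)"
    by (intro differentiable_Pair) simp_all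
  ultimately have "(w \<circ> (\<lambda>t. (x, t))) differentiable (at t)"
    by (intro differentiable_chain_at) simp_all
  then show "((\<lambda>t. w (x, t)) has_vector_derivative partial2 w (x, t)) (at t)"
    by (simp add: partial2_def o_def vector_derivative_works)
qed

lemma integral_derivative_eq_0:
  fixes f :: "real \<Rightarrow> complex"
  assumes f: "\<And>t. (f has_vector_derivative f' t) (at t)" and cont: "\<And>t. isCont f' t"
    and int: "integrable lborel f'" and bound: "\<And>t. norm (f t) \<le> C / (1 + t\<^sup>2)"
  shows "integral\<^sup>L lborel f' = 0"
proof -
  have lim: "(f \<longlongrightarrow> 0) at_top" "(f \<longlongrightarrow> 0) at_bot"
  proof -
    have 0: "((\<lambda>t. C / (1 + t\<^sup>2)) \<longlongrightarrow> 0) at_top" "((\<lambda>t. C / (1 + t\<^sup>2)) \<longlongrightarrow> 0) at_bot"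
      by - real_asymp+
    show "(f \<longlongrightarrow> 0) at_top" "(f \<longlongrightarrow> 0) at_bot"
      by (rule Lim_null_comparison[OF always_eventually 0(1)] Lim_null_comparison[OF always_eventually 0(2)];
          use bound in blast)+
  qed
  have "(LBINT t=-\<infinity>..\<infinity>. f' t) = 0 - 0"
    by (rule interval_integral_FTC_integrable[of _ _ f])
       (use f cont lim int in \<open>auto simp: ereal_tendsto_simps set_integrable_def\<close>)
  then show ?thesis
    by (simp add: interval_lebesgue_integral_def set_lebesgue_integral_def)
qed

lemma borel_measurable_decaying: "decaying w \<Longrightarrow> w \<in> borel_measurable borel"
  using borel_measurable_continuous_onI[OF decaying_continuous] .

lemma integrable_mult_exp:
  assumes "decaying w"
  shows "integrable lborel (\<lambda>x. w x * exp (- \<i> * of_real (k \<bullet> x)))"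
proof -
  have [measurable]: "w \<in> borel_measurable borel" by (rule borel_measurable_decaying[OF assms])
  show ?thesis
    by (rule Bochner_Integration.integrable_bound[OF decaying_integrable[OF assms]]) (simp_all add: norm_mult)
qed

lemma norm_fourier_le:
  assumes "decaying w"
  shows "norm (fourier w k) \<le> (LINT x|lborel. norm (w x))"
proof -
  have "norm (fourier w k) \<le> (LINT x|lborel. norm (w x * exp (- \<i> * of_real (k \<bullet> x))))"
    unfolding fourier_def by (rule integral_norm_bound)
  then show ?thesis by (simp add: norm_mult)
qed

lemma has_vector_derivative_mult_exp:
  fixes f :: "real \<Rightarrow> complex"
  assumes "(f has_vector_derivative f') (at t)"
  shows "((\<lambda>t. f t * exp (- \<i> * of_real (a * t + b))) has_vector_derivative
     (f' - \<i> * of_real a * f t) * exp (- \<i> * of_real (a * t + b))) (at t)"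
proof -
  have "((\<lambda>t. exp (- \<i> * of_real (a * t + b))) has_vector_derivative
      of_real a * (- \<i> * exp (- \<i> * of_real (a * t + b)))) (at t)"
  proof -
    have "((\<lambda>z. exp (- \<i> * (of_real a * z + of_real b))) has_field_derivative
        of_real a * (- \<i> * exp (- \<i> * (of_real a * of_real t + of_real b)))) (at (of_real t))"
      by (auto intro!: derivative_eq_intros)
    from has_vector_derivative_real_field[OF this] show ?thesis by simp
  qed
  from has_vector_derivative_mult[OF assms this] show ?thesis
    by (rule has_vector_derivative_eq_rhs) (simp add: algebra_simps)
qed

text \<open>The integrand \<open>g\<close> is the first partial derivative of
  \<open>w x * exp (- \<i> * of_real (k \<bullet> x))\<close>, so its integral along almost every
  horizontal line is 0. By Fubini its integral over the plane is 0, and splitting \<open>g\<close>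
  gives the claim.\<close>

lemma fourier_partial1:
  assumes w: "decaying w" and w': "decaying (partial1 w)"
  shows "fourier (partial1 w) k = \<i> * of_real (fst k) * fourier w k"
proof -
  define g where "g = (\<lambda>x. (partial1 w x - \<i> * of_real (fst k) * w x) * exp (- \<i> * of_real (k \<bullet> x)))"
  have g: "g = (\<lambda>x. partial1 w x * exp (- \<i> * of_real (k \<bullet> x))
      - \<i> * of_real (fst k) * (w x * exp (- \<i> * of_real (k \<bullet> x))))"
    by (simp add: g_def fun_eq_iff algebra_simps)
  have gi: "integrable lborel g"
    unfolding g by (intro Bochner_Integration.integrable_diff integrable_mult_right integrable_mult_exp w w')
  then have gi': "integrable (lborel \<Otimes>\<^sub>M lborel) (\<lambda>(t, y). g (t, y))"
    by (simp add: lborel_prod)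
  have contg: "continuous_on UNIV g"
    unfolding g_def by (intro continuous_intros decaying_continuous w w')
  obtain C where C: "\<And>x. norm (w x) \<le> C / ((1 + (fst x)\<^sup>2) * (1 + (snd x)\<^sup>2))"
    using w unfolding decaying_def by blast
  \<comment> \<open>Almost every line is enough for the iterated integral, and Fubini then provides
    integrability on the line without a further estimate.\<close>
  have "AE y in lborel. integrable lborel (\<lambda>t. g (t, y))"
    using lborel_pair.AE_integrable_snd[OF gi'] .
  then have "AE y in lborel. (LINT t|lborel. g (t, y)) = 0"
  proof eventually_elim
    case (elim y)
    show ?case
    proof (rule integral_derivative_eq_0)
      show "((\<lambda>t. w (t, y) * exp (- \<i> * of_real (fst k * t + snd k * y))) has_vector_derivative g (t, y)) (at t)" for t
        using has_vector_derivative_mult_exp[OF decaying_partials(1)[OF w, of y t], of "fst k" "snd k * y"]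
        by (simp add: g_def inner_prod_def)
      show "isCont (\<lambda>t. g (t, y)) t" for t
        using continuous_on_compose2[OF contg, of UNIV "\<lambda>t. (t, y)"]
        by (simp add: continuous_on_eq_continuous_at continuous_on_Pair)
      show "norm (w (t, y) * exp (- \<i> * of_real (fst k * t + snd k * y))) \<le> (C / (1 + y\<^sup>2)) / (1 + t\<^sup>2)" for t
        using C[of "(t, y)"] by (simp add: norm_mult mult.commute)
    qed (rule elim)
  qed
  then have "(LINT y|lborel. (LINT t|lborel. g (t, y))) = (LINT y|(lborel :: real measure). 0)"
    by (intro integral_cong_AE) (use lborel_pair.integrable_snd[OF gi'] in auto)
  then have "integral\<^sup>L lborel g = 0"
    using lborel_pair.integral_snd[OF gi'] by (simp add: lborel_prod)
  moreover have "integral\<^sup>L lborel g = fourier (partial1 w) k - \<i> * of_real (fst k) * fourier w k"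
    unfolding g fourier_def
    by (simp only: Bochner_Integration.integral_diff[OF integrable_mult_exp[OF w', of k]
          integrable_mult_right[OF integrable_mult_exp[OF w, of k]]] integral_mult_right_zero)
  ultimately show ?thesis by simp
qed

lemma fourier_partial2:
  assumes w: "decaying w" and w': "decaying (partial2 w)"
  shows "fourier (partial2 w) k = \<i> * of_real (snd k) * fourier w k"
proof -
  define g where "g = (\<lambda>x. (partial2 w x - \<i> * of_real (snd k) * w x) * exp (- \<i> * of_real (k \<bullet> x)))"
  have g: "g = (\<lambda>x. partial2 w x * exp (- \<i> * of_real (k \<bullet> x))
      - \<i> * of_real (snd k) * (w x * exp (- \<i> * of_real (k \<bullet> x))))"
    by (simp add: g_def fun_eq_iff algebra_simps)
  have gi: "integrable lborel g"
    unfolding g by (intro Bochner_Integration.integrable_diff integrable_mult_right integrable_mult_exp w w')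
  then have gi': "integrable (lborel \<Otimes>\<^sub>M lborel) (\<lambda>(x, t). g (x, t))"
    by (simp add: lborel_prod)
  have contg: "continuous_on UNIV g"
    unfolding g_def by (intro continuous_intros decaying_continuous w w')
  obtain C where C: "\<And>x. norm (w x) \<le> C / ((1 + (fst x)\<^sup>2) * (1 + (snd x)\<^sup>2))"
    using w unfolding decaying_def by blast
  have "AE x in lborel. integrable lborel (\<lambda>t. g (x, t))"
    using lborel_pair.AE_integrable_fst[OF gi'] .
  then have "AE x in lborel. (LINT t|lborel. g (x, t)) = 0"
  proof eventually_elim
    case (elim x)
    show ?case
    proof (rule integral_derivative_eq_0)
      show "((\<lambda>t. w (x, t) * exp (- \<i> * of_real (snd k * t + fst k * x))) has_vector_derivative g (x, t)) (at t)" for t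
        using has_vector_derivative_mult_exp[OF decaying_partials(2)[OF w, of x t], of "snd k" "fst k * x"]
        by (simp add: g_def inner_prod_def add.commute)
      show "isCont (\<lambda>t. g (x, t)) t" for t
        using continuous_on_compose2[OF contg, of UNIV "\<lambda>t. (x, t)"]
        by (simp add: continuous_on_eq_continuous_at continuous_on_Pair)
      show "norm (w (x, t) * exp (- \<i> * of_real (snd k * t + fst k * x))) \<le> (C / (1 + x\<^sup>2)) / (1 + t\<^sup>2)" for t
        using C[of "(x, t)"] by (simp add: norm_mult mult.commute)
    qed (rule elim)
  qed
  then have "(LINT x|lborel. (LINT t|lborel. g (x, t))) = (LINT x|(lborel :: real measure). 0)"
    by (intro integral_cong_AE) (use lborel_pair.integrable_fst[OF gi'] in auto)
  then have "integral\<^sup>L lborel g = 0"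
    using lborel_pair.integral_fst[OF gi'] by (simp add: lborel_prod)
  moreover have "integral\<^sup>L lborel g = fourier (partial2 w) k - \<i> * of_real (snd k) * fourier w k"
    unfolding g fourier_def
    by (simp only: Bochner_Integration.integral_diff[OF integrable_mult_exp[OF w', of k]
          integrable_mult_right[OF integrable_mult_exp[OF w, of k]]] integral_mult_right_zero)
  ultimately show ?thesis by simp
qed

text \<open>The derivatives are taken in the order in which \<open>schwartz\<close> controls them,
  so the induction never has to commute \<open>partial1\<close> with \<open>partial2\<close>: the
  exponent \<open>b\<close> is exhausted first, with \<open>a = 0\<close>.\<close>

lemma fourier_schwartz_derivative:
  assumes "schwartz u"
  shows "fourier ((partial1 ^^ a) ((partial2 ^^ b) u)) k = (\<i> * of_real (fst k)) ^ a * (\<i> * of_real (snd k)) ^ b * fourier u k"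
proof (induction a)
  case 0
  show ?case
  proof (induction b)
    case (Suc b)
    have "fourier (partial2 ((partial2 ^^ b) u)) k = \<i> * of_real (snd k) * fourier ((partial2 ^^ b) u) k"
      using decaying_schwartz[OF assms, of 0 b] decaying_schwartz[OF assms, of 0 "Suc b"]
      by (intro fourier_partial2) simp_all
    with Suc show ?case by simp
  qed simp
next
  case (Suc a)
  have "fourier (partial1 ((partial1 ^^ a) ((partial2 ^^ b) u))) k =
      \<i> * of_real (fst k) * fourier ((partial1 ^^ a) ((partial2 ^^ b) u)) k"
    using decaying_schwartz[OF assms, of a b] decaying_schwartz[OF assms, of "Suc a" b]
    by (intro fourier_partial1) simp_all
  with Suc show ?case by simp
qed

text \<open>The weight \<open>1 + norm k\<close> pays for the linear growth of
  \<open>L_symbol\<close> and of the integral of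
  \<open>(1 - cos (k \<bullet> y)) * \<bar>K_fun \<beta> y\<bar>\<close>; the remaining decay is
  still integrable.\<close>

lemma fourier_schwartz_decay:
  assumes u: "schwartz u"
  obtains C where "\<And>k. (1 + norm k) * norm (fourier u k) \<le> C / ((1 + (fst k)\<^sup>2) * (1 + (snd k)\<^sup>2))"
proof
  define M where "M = (\<lambda>a b. LINT x|lborel. norm ((partial1 ^^ a) ((partial2 ^^ b) u) x))"
  have M: "\<bar>fst k\<bar> ^ a * \<bar>snd k\<bar> ^ b * norm (fourier u k) \<le> M a b" for a b k
    using norm_fourier_le[OF decaying_schwartz[OF u, of a b], of k]
    unfolding fourier_schwartz_derivative[OF u] M_def by (simp add: norm_mult norm_power)
  \<comment> \<open>One term for each monomial of
    \<open>(1 + p + q) * (1 + p\<^sup>2) * (1 + q\<^sup>2)\<close>, where \<open>1 + p + q\<close>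
    dominates \<open>1 + norm k\<close>.\<close>
  define C where "C = M 0 0 + M 1 0 + M 0 1 + (M 2 0 + M 3 0 + M 2 1) + (M 0 2 + M 1 2 + M 0 3) + (M 2 2 + M 3 2 + M 2 3)"
  show "(1 + norm k) * norm (fourier u k) \<le> C / ((1 + (fst k)\<^sup>2) * (1 + (snd k)\<^sup>2))" for k
  proof -
    define p q f where "p = \<bar>fst k\<bar>" and "q = \<bar>snd k\<bar>" and "f = norm (fourier u k)"
    have n: "norm k \<le> p + q"
      using norm_Pair_le[of "fst k" "snd k"] by (simp add: p_def q_def)
    have "(1 + norm k) * f * ((1 + p\<^sup>2) * (1 + q\<^sup>2)) \<le> (1 + (p + q)) * f * ((1 + p\<^sup>2) * (1 + q\<^sup>2))"
      using n by (intro mult_right_mono) (auto simp: f_def)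
    also have "\<dots> = p^0*q^0*f + p^1*q^0*f + p^0*q^1*f + (p^2*q^0*f + p^3*q^0*f + p^2*q^1*f)
       + (p^0*q^2*f + p^1*q^2*f + p^0*q^3*f) + (p^2*q^2*f + p^3*q^2*f + p^2*q^3*f)"
      by (simp add: algebra_simps power2_eq_square power3_eq_cube)
    also have "\<dots> \<le> C"
      unfolding C_def p_def q_def f_def by (intro add_mono M)
    finally have "(1 + norm k) * f * ((1 + p\<^sup>2) * (1 + q\<^sup>2)) \<le> C" .
    then show ?thesis
      by (subst pos_le_divide_eq) (auto intro!: mult_pos_pos add_pos_nonneg simp: p_def q_def f_def)
  qed
qed

lemma borel_measurable_fourier [measurable]:
  assumes [measurable]: "u \<in> borel_measurable borel"
  shows "fourier u \<in> borel_measurable borel"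
  unfolding fourier_def by measurable

lemma integrable_fourier_schwartz:
  assumes u: "schwartz u"
  shows "integrable lborel (\<lambda>k. norm k * norm (fourier u k))" "integrable lborel (fourier u)"
proof -
  obtain C where C: "\<And>k. (1 + norm k) * norm (fourier u k) \<le> C / ((1 + (fst k)\<^sup>2) * (1 + (snd k)\<^sup>2))"
    using fourier_schwartz_decay[OF u] by blast
  have [measurable]: "u \<in> borel_measurable borel"
    using borel_measurable_decaying[OF decaying_schwartz[OF u, of 0 0]] by simp
  have 1: "integrable lborel (\<lambda>k. (1 + norm k) * norm (fourier u k))"
    by (rule integrable_of_decay[of _ C]) (use C in simp_all)
  show "integrable lborel (\<lambda>k. norm k * norm (fourier u k))" "integrable lborel (fourier u)"
    by (rule Bochner_Integration.integrable_bound[OF 1]; simp add: distrib_right)+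
qed

section \<open>The integral representation\<close>

text \<open>Discards the frequencies at which the slope \<open>- fst k / snd k\<close> is
  undefined.\<close>

lemma AE_snd_nonzero: "AE k in (lborel :: (real \<times> real) measure). snd k \<noteq> 0"
proof -
  have "AE k in (lborel \<Otimes>\<^sub>M lborel :: (real \<times> real) measure). snd k \<noteq> 0"
  proof (rule lborel_pair.AE_pair_measure)
    show "AE x in lborel. AE y in lborel. snd (x::real, y::real) \<noteq> 0"
      using AE_lborel_singleton[of "0::real"] by simp
  qed measurable
  then show ?thesis unfolding lborel_prod .
qed

text \<open>Ellipticity: the denominator is at least
  \<open>min 1 \<beta> * (norm k)\<^sup>2\<close>. At \<open>k = 0\<close> the symbol is 0 by
  division by 0, which is also its continuous value there.\<close>

lemma L_symbol_le:
  assumes \<beta>: "\<beta> > 0"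
  shows "\<bar>L_symbol \<beta> k\<bar> \<le> norm k / min 1 \<beta>"
proof (cases "k = 0")
  case False
  define c where "c = min 1 \<beta>"
  have c: "c > 0" "c \<le> 1" "c \<le> \<beta>" using \<beta> by (auto simp: c_def)
  have n: "norm k > 0" using False by simp
  have q: "c * (norm k)\<^sup>2 \<le> \<beta> * (fst k)\<^sup>2 + (snd k)\<^sup>2"
    using c mult_right_mono[OF c(2), of "(snd k)\<^sup>2"]
    by (simp add: norm_prod_def distrib_left add_mono mult_right_mono)
  have q0: "0 < c * (norm k)\<^sup>2" using c n by simp
  have "\<bar>L_symbol \<beta> k\<bar> = norm k ^ 3 / (\<beta> * (fst k)\<^sup>2 + (snd k)\<^sup>2)"
    using \<beta> by (simp add: L_symbol_def)
  also have "\<dots> \<le> norm k ^ 3 / (c * (norm k)\<^sup>2)"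
    by (rule divide_left_mono[OF q _ mult_pos_pos[OF less_le_trans[OF q0 q] q0]]) simp
  also have "\<dots> = norm k / c"
    using n c by (simp add: field_simps power2_eq_square power3_eq_cube)
  finally show ?thesis by (simp add: c_def)
qed (simp add: L_symbol_def)

text \<open>\<open>(1 - cos (k \<bullet> y)) * exp (\<i> * of_real (k \<bullet> x))\<close> is minus
  half the second difference of the exponential at \<open>x\<close> with step \<open>y\<close>.
  Integrating against \<open>fourier u\<close> and \<open>K_fun \<beta>\<close> therefore gives the
  symbol in one order of integration and the second difference of \<open>u\<close> in the
  other.\<close>

lemma
  assumes \<beta>: "\<beta> > 0" and u: "schwartz u"
  shows integrable_L_symbol_fourier: "integrable lborel (\<lambda>k. of_real (L_symbol \<beta> k) * fourier u k)"
    and integrable_second_difference: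
      "integrable lborel (\<lambda>y. (u (x + y) + u (x - y) - 2 * u x) * of_real (K_fun \<beta> y))"
    and L_op_eq_integral: "L_op \<beta> u x = - of_real (1 / (4 * pi)) *
      (LINT y|lborel. (u (x + y) + u (x - y) - 2 * u x) * of_real (K_fun \<beta> y))"
proof -
  have r: "decaying u" using decaying_schwartz[OF u, of 0 0] by simp
  note [measurable] = borel_measurable_decaying[OF r] borel_measurable_K_fun[OF \<beta>]
  obtain C where C: "\<And>x. norm (u x) \<le> C / ((1 + (fst x)\<^sup>2) * (1 + (snd x)\<^sup>2))"
    using r unfolding decaying_def by blast
  have bounded: "norm (u x) \<le> \<bar>C\<bar>" for x
  proof -
    have "1 * 1 \<le> (1 + (fst x)\<^sup>2) * (1 + (snd x)\<^sup>2)" by (intro mult_mono) auto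
    then have "\<bar>C\<bar> / ((1 + (fst x)\<^sup>2) * (1 + (snd x)\<^sup>2)) \<le> \<bar>C\<bar> / 1"
      by (intro divide_left_mono) auto
    moreover have "C / ((1 + (fst x)\<^sup>2) * (1 + (snd x)\<^sup>2)) \<le> \<bar>C\<bar> / ((1 + (fst x)\<^sup>2) * (1 + (snd x)\<^sup>2))"
      by (intro divide_right_mono) auto
    ultimately show ?thesis using C[of x] by linarith
  qed
  note inversion = fourier_inversion[OF decaying_continuous[OF r] bounded decaying_integrable[OF r] integrable_fourier_schwartz(2)[OF u]]
  have [measurable]: "L_symbol \<beta> \<in> borel_measurable borel"
    unfolding L_symbol_def by measurable
  show Li: "integrable lborel (\<lambda>k. of_real (L_symbol \<beta> k) * fourier u k)"
  proof (rule Bochner_Integration.integrable_bound)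
    show "integrable lborel (\<lambda>k. 1 / min 1 \<beta> * (norm k * norm (fourier u k)))"
      by (intro integrable_mult_right integrable_fourier_schwartz u)
    have "norm (of_real (L_symbol \<beta> k) * fourier u k) \<le> norm (1 / min 1 \<beta> * (norm k * norm (fourier u k)))" for k
      using mult_right_mono[OF L_symbol_le[OF \<beta>, of k], of "norm (fourier u k)"] \<beta>
      by (simp add: norm_mult abs_mult)
    then show "AE k in lborel. norm (of_real (L_symbol \<beta> k) * fourier u k) \<le> norm (1 / min 1 \<beta> * (norm k * norm (fourier u k)))"
      by (intro AE_I2)
  qed simp
  obtain C0 where C0: "\<And>k. (LINT y|lborel. (1 - cos (k \<bullet> y)) * \<bar>K_fun \<beta> y\<bar>) \<le> C0 * norm k"
    using integral_abs_K_fun[OF \<beta>] by blast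
  \<comment> \<open>With the phase at \<open>x\<close> built in, inversion of \<open>w\<close> at
    \<open>z\<close> returns \<open>u (x + z)\<close>; only \<open>z = 0\<close>, \<open>y\<close>
    and \<open>- y\<close> occur below.\<close>
  define w where "w = (\<lambda>k. fourier u k * exp (\<i> * of_real (k \<bullet> x)))"
  have nw: "norm (w k) = norm (fourier u k)" for k
    by (simp add: w_def norm_mult)
  have [measurable]: "w \<in> borel_measurable borel" unfolding w_def by measurable
  define \<Phi> where "\<Phi> = (\<lambda>k y. w k * of_real ((1 - cos (k \<bullet> y)) * K_fun \<beta> y))"
  have [measurable]: "(\<lambda>(k, y). \<Phi> k y) \<in> borel_measurable (lborel \<Otimes>\<^sub>M lborel)"
    unfolding \<Phi>_def by measurable
  have Ky: "integrable lborel (\<Phi> k)" for k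
    unfolding \<Phi>_def by (intro integrable_mult_right integrable_of_real integrable_K_fun[OF \<beta>])
  have int: "integrable (lborel \<Otimes>\<^sub>M lborel) (\<lambda>(k, y). \<Phi> k y)"
  proof (rule lborel_pair.Fubini_integrable)
    show "AE k in lborel. integrable lborel (\<lambda>y. (\<lambda>(k, y). \<Phi> k y) (k, y))"
      using Ky by simp
    have n: "norm (\<Phi> k y) = norm (fourier u k) * ((1 - cos (k \<bullet> y)) * \<bar>K_fun \<beta> y\<bar>)" for k y
      unfolding \<Phi>_def norm_mult nw norm_of_real abs_mult by simp
    \<comment> \<open>The bound for \<open>\<bar>K_fun \<beta>\<bar>\<close> leaves
      \<open>norm k * norm (fourier u k)\<close>, integrable by the decay of the transform.\<close>
    have "norm (LINT y|lborel. norm (\<Phi> k y)) \<le> norm (C0 * (norm k * norm (fourier u k)))" for k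
    proof -
      have "norm (LINT y|lborel. norm (\<Phi> k y)) = (LINT y|lborel. norm (\<Phi> k y))" by simp
      also have "\<dots> = norm (fourier u k) * (LINT y|lborel. (1 - cos (k \<bullet> y)) * \<bar>K_fun \<beta> y\<bar>)"
        unfolding n by (rule integral_mult_right_zero)
      also have "\<dots> \<le> norm (fourier u k) * (C0 * norm k)"
        by (intro mult_left_mono C0) simp
      also have "\<dots> \<le> norm (C0 * (norm k * norm (fourier u k)))"
        unfolding real_norm_def by (rule order_trans[OF _ abs_ge_self]) simp
      finally show ?thesis .
    qed
    then have "AE k in lborel. norm (LINT y|lborel. norm (\<Phi> k y)) \<le> norm (C0 * (norm k * norm (fourier u k)))"
      by (intro AE_I2)
    moreover have "(\<lambda>k. LINT y|lborel. norm (\<Phi> k y)) \<in> borel_measurable lborel"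
      by measurable
    ultimately have "integrable lborel (\<lambda>k. LINT y|lborel. norm (\<Phi> k y))"
      using Bochner_Integration.integrable_bound[OF integrable_mult_right[OF integrable_fourier_schwartz(1)[OF u], of C0]]
      by blast
    then show "integrable lborel (\<lambda>k. LINT y|lborel. norm ((\<lambda>(k, y). \<Phi> k y) (k, y)))" by simp
  qed simp
  have wi: "integrable lborel (\<lambda>k. w k * exp (\<i> * of_real (k \<bullet> z)))" for z
    by (rule Bochner_Integration.integrable_bound[OF integrable_fourier_schwartz(2)[OF u]])
       (simp_all add: norm_mult nw)
  have wz: "(LINT k|lborel. w k * exp (\<i> * of_real (k \<bullet> z))) = of_real ((2 * pi)\<^sup>2) * u (x + z)" for z
    using inversion[of "x + z"]
    by (simp add: w_def inner_add_right distrib_left exp_add mult.assoc)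
  \<comment> \<open>The cosine is split into exponentials, so inversion applies three times. Half of
    the inversion constant \<open>(2 * pi)\<^sup>2\<close> gives the factor
    \<open>2 * pi\<^sup>2\<close>.\<close>
  have inner_k: "(LINT k|lborel. \<Phi> k y) = - of_real (2 * pi\<^sup>2) * ((u (x + y) + u (x - y) - 2 * u x) * of_real (K_fun \<beta> y))" for y
  proof -
    have "\<Phi> k y = (w k * exp (\<i> * of_real (k \<bullet> 0)) - (1 / 2) * (w k * exp (\<i> * of_real (k \<bullet> y)))
        - (1 / 2) * (w k * exp (\<i> * of_real (k \<bullet> (- y))))) * of_real (K_fun \<beta> y)" for k
    proof -
      have "of_real (cos (k \<bullet> y)) = (exp (\<i> * of_real (k \<bullet> y)) + exp (\<i> * of_real (k \<bullet> (- y)))) / 2"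
        by (simp add: cos_of_real[symmetric] cos_exp_eq)
      then show ?thesis
        by (simp add: \<Phi>_def algebra_simps add_divide_distrib)
    qed
    then have "(LINT k|lborel. \<Phi> k y) = (LINT k|lborel. (w k * exp (\<i> * of_real (k \<bullet> 0)) - (1 / 2) * (w k * exp (\<i> * of_real (k \<bullet> y)))
        - (1 / 2) * (w k * exp (\<i> * of_real (k \<bullet> (- y))))) * of_real (K_fun \<beta> y))"
      by (simp only:)
    also have "\<dots> = (of_real ((2 * pi)\<^sup>2) * u (x + 0) - (1 / 2) * (of_real ((2 * pi)\<^sup>2) * u (x + y))
        - (1 / 2) * (of_real ((2 * pi)\<^sup>2) * u (x + (- y)))) * of_real (K_fun \<beta> y)"
      by (simp only: integral_mult_left_zero integral_mult_right_zero wz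
          Bochner_Integration.integral_diff[OF Bochner_Integration.integrable_diff[OF wi integrable_mult_right[OF wi]] integrable_mult_right[OF wi]]
          Bochner_Integration.integral_diff[OF wi integrable_mult_right[OF wi]])
    also have "\<dots> = - of_real (2 * pi\<^sup>2) * ((u (x + y) + u (x - y) - 2 * u x) * of_real (K_fun \<beta> y))"
      by (simp add: power_mult_distrib algebra_simps)
    finally show ?thesis .
  qed
  \<comment> \<open>Integrability of the second difference against the singular kernel comes for
    free as a marginal of \<open>\<Phi>\<close>; no Taylor estimate at the origin is made.\<close>
  have "integrable lborel (\<lambda>y. LINT k|lborel. \<Phi> k y)"
    using lborel_pair.integrable_snd[OF int] .
  then have "integrable lborel (\<lambda>y. - of_real (1 / (2 * pi\<^sup>2)) * (- of_real (2 * pi\<^sup>2) * ((u (x + y) + u (x - y) - 2 * u x) * of_real (K_fun \<beta> y))))"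
    unfolding inner_k by (rule integrable_mult_right)
  then show "integrable lborel (\<lambda>y. (u (x + y) + u (x - y) - 2 * u x) * of_real (K_fun \<beta> y))"
    by simp
  \<comment> \<open>Only an almost-everywhere equality of the inner integrals, since the symbol was
    computed for \<open>snd k \<noteq> 0\<close>.\<close>
  have "(LINT k|lborel. LINT y|lborel. \<Phi> k y) = (LINT k|lborel. of_real (2 * pi) * (of_real (L_symbol \<beta> k) * fourier u k * exp (\<i> * of_real (k \<bullet> x))))"
  proof (rule integral_cong_AE)
    show "AE k in lborel. (LINT y|lborel. \<Phi> k y) = of_real (2 * pi) * (of_real (L_symbol \<beta> k) * fourier u k * exp (\<i> * of_real (k \<bullet> x)))"
      using AE_snd_nonzero
    proof eventually_elim
      case (elim k)
      then show ?case
        unfolding \<Phi>_def by (simp only: integral_mult_right_zero integral_complex_of_real integral_K_fun[OF \<beta> elim])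
          (simp add: w_def mult_ac)
    qed
  next
    show "(\<lambda>k. LINT y|lborel. \<Phi> k y) \<in> borel_measurable lborel"
      using lborel_pair.integrable_fst[OF int] by (rule borel_measurable_integrable)
    have [measurable]: "fourier u \<in> borel_measurable borel"
      using integrable_fourier_schwartz(2)[OF u] by simp
    show "(\<lambda>k. of_real (2 * pi) * (of_real (L_symbol \<beta> k) * fourier u k * exp (\<i> * of_real (k \<bullet> x)))) \<in> borel_measurable lborel"
      by measurable
  qed
  moreover have "(LINT k|lborel. LINT y|lborel. \<Phi> k y) = (LINT y|lborel. LINT k|lborel. \<Phi> k y)"
    using lborel_pair.Fubini_integral[OF int, symmetric] .
  ultimately have "of_real (2 * pi) * (LINT k|lborel. of_real (L_symbol \<beta> k) * fourier u k * exp (\<i> * of_real (k \<bullet> x)))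
      = - of_real (2 * pi\<^sup>2) * (LINT y|lborel. (u (x + y) + u (x - y) - 2 * u x) * of_real (K_fun \<beta> y))"
    unfolding inner_k by (simp only: integral_mult_right_zero)
  then have "of_real (2 * pi) * (LINT k|lborel. of_real (L_symbol \<beta> k) * fourier u k * exp (\<i> * of_real (k \<bullet> x)))
      = of_real (2 * pi) * (- of_real pi * (LINT y|lborel. (u (x + y) + u (x - y) - 2 * u x) * of_real (K_fun \<beta> y)))"
    by (simp only: of_real_mult power2_eq_square mult_ac mult_minus_left mult_minus_right)
  then have "(LINT k|lborel. of_real (L_symbol \<beta> k) * fourier u k * exp (\<i> * of_real (k \<bullet> x)))
      = - of_real pi * (LINT y|lborel. (u (x + y) + u (x - y) - 2 * u x) * of_real (K_fun \<beta> y))"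
    by (subst (asm) mult_cancel_left) simp
  then show "L_op \<beta> u x = - of_real (1 / (4 * pi)) *
      (LINT y|lborel. (u (x + y) + u (x - y) - 2 * u x) * of_real (K_fun \<beta> y))"
    \<comment> \<open>The constant is \<open>pi\<close> times the normalization
      \<open>1 / (2 * pi)\<^sup>2\<close>, that is, \<open>1 / (4 * pi)\<close>.\<close>
    unfolding L_op_def inverse_fourier_def by (simp add: power2_eq_square)
qed

text \<open>The integrability and differentiability conjuncts give the equations their meaning: a
  Bochner integral defaults to 0 when it does not exist, and \<open>vector_derivative\<close> is
  total. Differentiability of the first partial derivatives ensures that the second ones
  exist.\<close>

theorem proposition3p2:
  fixes \<nu> \<beta> :: real
  assumes "\<nu> \<in> {-1..1/2}" and "\<beta> = 1 - \<nu>"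
  shows "(\<forall>u x. schwartz u \<longrightarrow>
            integrable lborel (\<lambda>k. of_real (L_symbol \<beta> k) * fourier u k) \<and>
            integrable lborel (\<lambda>y. (u (x + y) + u (x - y) - 2 * u x) * of_real (K_fun \<beta> y)) \<and>
            L_op \<beta> u x =
              - of_real (1 / (4 * pi)) *
              (LINT y|lborel. (u (x + y) + u (x - y) - 2 * u x) * of_real (K_fun \<beta> y)))
       \<and> (\<forall>y. y \<noteq> 0 \<longrightarrow>
            K_fun \<beta> differentiable (at y) \<and>
            partial1 (K_fun \<beta>) differentiable (at y) \<and>
            partial2 (K_fun \<beta>) differentiable (at y) \<and>
            \<beta> * partial1 (partial1 (K_fun \<beta>)) y + partial2 (partial2 (K_fun \<beta>)) y
              = 9 / norm y ^ 5)"
proof -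
  have "\<beta> > 0" using assms by simp
  then show ?thesis
    by (intro conjI allI impI integrable_L_symbol_fourier integrable_second_difference L_op_eq_integral
        K_fun_differentiable K_fun_pde)
qed

end
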